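(* Let $\Lambda\subset\mathbb{R}$ be a discrete set. There exists a function $\varphi\in L^1(\mathbb{R})$ such that the linear span of the translates $\varphi(t-\lambda)$, $\lambda\in\Lambda$, is dense in $L^1(\mathbb{R})$ if and only if $R(\Lambda)=+\infty$.
   Context: For $\Lambda\subset\mathbb{R}$, let $\mathcal{E}(\Lambda)$ denote the linear span of the exponentials $e^{i\lambda\zeta}$, $\lambda\in\Lambda$. The spectral (completeness) radius is $R(\Lambda)=\sup\{\rho>0:\ \mathcal{E}(\Lambda)\text{ is complete (dense) in } C[-\rho,\rho]\}$, with $R(\Lambda)=0$ if $\mathcal{E}(\Lambda)$ is complete in $C[-\rho,\rho]$ for no $\rho>0$. Here $C[-\rho,\rho]$ is the space of continuous functions on $[-\rho,\rho]$ with the sup-norm. *)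

theory Defs
  imports "HOL-Analysis.Analysis"
begin

definition discrete_real_set :: "real set \<Rightarrow> bool" where
  "discrete_real_set \<Lambda> \<longleftrightarrow> (\<forall>x::real. \<not> x islimpt \<Lambda>)"

definition exp_complete :: "real set \<Rightarrow> real \<Rightarrow> bool" where
  "exp_complete \<Lambda> \<rho> \<longleftrightarrow>
     (\<forall>f :: real \<Rightarrow> complex. continuous_on {-\<rho>..\<rho>} f \<longrightarrow>
        (\<forall>\<epsilon>>0. \<exists>F c. finite F \<and> F \<subseteq> \<Lambda> \<and>
           (\<forall>x\<in>{-\<rho>..\<rho>}. norm (f x - (\<Sum>l\<in>F. c l * exp (\<i> * complex_of_real (l * x)))) < \<epsilon>)))"

definition spectral_radius :: "real set \<Rightarrow> ereal" where
  "spectral_radius \<Lambda> =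
     (if {\<rho>::real. \<rho> > 0 \<and> exp_complete \<Lambda> \<rho>} = {} then 0
      else Sup (ereal ` {\<rho>::real. \<rho> > 0 \<and> exp_complete \<Lambda> \<rho>}))"

definition translates_dense_L1 :: "(real \<Rightarrow> complex) \<Rightarrow> real set \<Rightarrow> bool" where
  "translates_dense_L1 \<phi> \<Lambda> \<longleftrightarrow>
     (\<forall>f :: real \<Rightarrow> complex. integrable lborel f \<longrightarrow>
        (\<forall>\<epsilon>>0. \<exists>F c. finite F \<and> F \<subseteq> \<Lambda> \<and>
           (\<integral>t. norm (f t - (\<Sum>l\<in>F. c l * \<phi> (t - l))) \<partial>lborel) < \<epsilon>))"

end

theory Submission
  imports Defs "HOL-Probability.Probability"
begin

text \<open>Write \<open>ft u\<close> for the Fourier transform. If the translates of \<open>\<phi>\<close> span a dense subspace, then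
  \<open>ft \<phi>\<close> has no zeros, and every \<open>ft \<phi> \<cdot> e\<^sup>i\<^sup>s\<^sup>x\<close> is a uniform limit of \<open>ft \<phi> \<cdot> E(\<Lambda>)\<close>; dividing by
  \<open>ft \<phi>\<close> on a compact interval and using the density of trigonometric polynomials gives completeness.

  Conversely, completeness on all intervals upgrades to density of \<open>E(\<Lambda>)\<close> in every \<open>C\<^sup>2[-\<rho>,\<rho>]\<close>. For compactly
  supported \<open>u\<close> the \<open>C\<^sup>2\<close> norm controls the \<open>L\<^sup>1\<close> norm of \<open>ft u\<close>, so if \<open>\<Phi> > 0\<close> near the support of \<open>h\<close>,
  approximating \<open>h / \<Phi>\<close> shows that \<open>ft h\<close> is an \<open>L\<^sup>1\<close> limit of combinations of \<open>\<Lambda>\<close>-translates of \<open>ft \<Phi>\<close>.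
  A category argument over a countable family of targets \<open>h\<close>, chosen such that the \<open>ft h\<close> approximate the
  indicators of rational intervals, produces one \<open>\<phi>\<close> that serves all of them.\<close>

section \<open>Twice continuously differentiable functions\<close>

text \<open>The obstacle is that completeness holds only on bounded intervals. A compactly supported
  \<open>\<Phi>\<close> generates only functions with spectrum in the support of
  \<open>\<Phi>\<close>, whereas the transform of the generator itself must be zero-free on the
  whole line. So no stage of the construction can be the answer, and \<open>\<phi>\<close> has to be
  an L1 limit of band-limited stages. Two features make the limit work. With the coefficients fixed,
  a combination of translates depends continuously on the generator, so an approximation once
  achieved survives all sufficiently small later changes. And the profiles \<open>\<Phi>\<close> are
  kept nonnegative, so adding a small multiple of a bump makes the profile positive on any
  prescribed interval: a generator good for the next target lies arbitrarily near the current one.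
  Passing to two derivatives is the price for the L1 norm: uniform smallness of a compactly
  supported function does not bound the integral of its transform, whereas two derivatives give
  decay like \<open>1 / (1 + t^2)\<close>.\<close>

definition has_C2_derivs ::
    "(real \<Rightarrow> 'a::real_normed_vector) \<Rightarrow> (real \<Rightarrow> 'a) \<Rightarrow> (real \<Rightarrow> 'a) \<Rightarrow> bool" where
  "has_C2_derivs u u1 u2 \<longleftrightarrow>
     (\<forall>x. (u has_vector_derivative u1 x) (at x)) \<and>
     (\<forall>x. (u1 has_vector_derivative u2 x) (at x)) \<and> continuous_on UNIV u2"

text \<open>The existential form serves the closure properties; estimates name the derivatives
  through \<open>has_C2_derivs\<close>, because their sizes enter the bounds.\<close>

definition C2 :: "(real \<Rightarrow> 'a::real_normed_vector) \<Rightarrow> bool" where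
  "C2 u \<longleftrightarrow> (\<exists>u1 u2. has_C2_derivs u u1 u2)"

lemma has_C2_derivs_continuous:
  assumes "has_C2_derivs u u1 u2"
  shows "continuous_on S u" "continuous_on S u1" "continuous_on S u2"
  using assms continuous_on_subset[of UNIV u2 S] unfolding has_C2_derivs_def
  by (blast intro: continuous_at_imp_continuous_on has_vector_derivative_continuous)+

lemma C2_continuous: "C2 u \<Longrightarrow> continuous_on S u"
  unfolding C2_def using has_C2_derivs_continuous(1) by blast

lemma has_C2_derivs_add:
  "has_C2_derivs u u1 u2 \<Longrightarrow> has_C2_derivs v v1 v2 \<Longrightarrow>
    has_C2_derivs (\<lambda>x. u x + v x) (\<lambda>x. u1 x + v1 x) (\<lambda>x. u2 x + v2 x)"
  unfolding has_C2_derivs_def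
  by (auto intro!: derivative_intros continuous_intros)

lemma has_C2_derivs_diff:
  "has_C2_derivs u u1 u2 \<Longrightarrow> has_C2_derivs v v1 v2 \<Longrightarrow>
    has_C2_derivs (\<lambda>x. u x - v x) (\<lambda>x. u1 x - v1 x) (\<lambda>x. u2 x - v2 x)"
  unfolding has_C2_derivs_def
  by (auto intro!: derivative_intros continuous_intros)

lemma has_C2_derivs_mult:
  fixes u v :: "real \<Rightarrow> 'a::real_normed_field"
  assumes u: "has_C2_derivs u u1 u2" and v: "has_C2_derivs v v1 v2"
  shows "has_C2_derivs (\<lambda>x. u x * v x) (\<lambda>x. u x * v1 x + u1 x * v x)
    (\<lambda>x. u x * v2 x + 2 * (u1 x * v1 x) + u2 x * v x)"
  unfolding has_C2_derivs_def
proof (intro conjI allI)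
  fix x
  show "((\<lambda>x. u x * v x) has_vector_derivative u x * v1 x + u1 x * v x) (at x)"
    using u v unfolding has_C2_derivs_def by (auto intro!: has_vector_derivative_mult)
  have "((\<lambda>x. u x * v1 x + u1 x * v x) has_vector_derivative
      (u x * v2 x + u1 x * v1 x) + (u1 x * v1 x + u2 x * v x)) (at x)"
    by (rule has_vector_derivative_add; rule has_vector_derivative_mult;
        use u v in \<open>simp add: has_C2_derivs_def\<close>)
  moreover have "(u x * v2 x + u1 x * v1 x) + (u1 x * v1 x + u2 x * v x)
      = u x * v2 x + 2 * (u1 x * v1 x) + u2 x * v x"
    by (simp add: algebra_simps)
  ultimately show "((\<lambda>x. u x * v1 x + u1 x * v x) has_vector_derivative
      u x * v2 x + 2 * (u1 x * v1 x) + u2 x * v x) (at x)"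
    by simp
qed (intro continuous_intros has_C2_derivs_continuous[OF u] has_C2_derivs_continuous[OF v])

lemma C2_add: "C2 u \<Longrightarrow> C2 v \<Longrightarrow> C2 (\<lambda>x. u x + v x)"
  unfolding C2_def using has_C2_derivs_add by blast

lemma C2_mult:
  fixes u v :: "real \<Rightarrow> 'a::real_normed_field"
  shows "C2 u \<Longrightarrow> C2 v \<Longrightarrow> C2 (\<lambda>x. u x * v x)"
  unfolding C2_def using has_C2_derivs_mult by blast

lemma C2_const: "C2 (\<lambda>x. c)"
  unfolding C2_def has_C2_derivs_def
  by (rule exI[of _ "\<lambda>x. 0"], rule exI[of _ "\<lambda>x. 0"]) auto

lemma C2_of_real:
  assumes "C2 (u :: real \<Rightarrow> real)"
  shows "C2 (\<lambda>x. complex_of_real (u x))"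
proof -
  obtain u1 u2 where "has_C2_derivs u u1 u2" using assms unfolding C2_def by blast
  then have "has_C2_derivs (\<lambda>x. complex_of_real (u x)) (\<lambda>x. of_real (u1 x)) (\<lambda>x. of_real (u2 x))"
    unfolding has_C2_derivs_def has_real_derivative_iff_has_vector_derivative[symmetric]
    by (auto intro!: has_vector_derivative_of_real continuous_intros)
  then show ?thesis unfolding C2_def by blast
qed

lemma C2_inverse:
  fixes u :: "real \<Rightarrow> real"
  assumes "C2 u" and nz: "\<And>x. u x \<noteq> 0"
  shows "C2 (\<lambda>x. inverse (u x))"
proof -
  obtain u1 u2 where u: "has_C2_derivs u u1 u2" using assms unfolding C2_def by blast
  then have d: "(u has_real_derivative u1 x) (at x)" "(u1 has_real_derivative u2 x) (at x)" for x
    unfolding has_C2_derivs_def has_real_derivative_iff_has_vector_derivative by auto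
  have "has_C2_derivs (\<lambda>x. inverse (u x)) (\<lambda>x. - u1 x / (u x)\<^sup>2)
      (\<lambda>x. - u2 x / (u x)\<^sup>2 + 2 * (u1 x)\<^sup>2 / (u x)^3)"
    unfolding has_C2_derivs_def has_real_derivative_iff_has_vector_derivative[symmetric]
  proof (intro conjI allI)
    fix x
    show "((\<lambda>x. inverse (u x)) has_real_derivative - u1 x / (u x)\<^sup>2) (at x)"
      by (rule derivative_eq_intros d refl nz)+ (simp add: nz field_simps power2_eq_square)
    show "((\<lambda>x. - u1 x / (u x)\<^sup>2) has_real_derivative
        - u2 x / (u x)\<^sup>2 + 2 * (u1 x)\<^sup>2 / (u x)^3) (at x)"
      by (rule derivative_eq_intros d refl | simp add: nz)+
         (simp add: nz field_simps power2_eq_square power3_eq_cube power4_eq_xxxx)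
  qed (intro continuous_intros has_C2_derivs_continuous[OF u]; simp add: nz)
  then show ?thesis unfolding C2_def by blast
qed

section \<open>Truncated powers and algebraic bump functions\<close>

lemma has_real_derivative_pos_part_power:
  assumes "n \<ge> 1"
  shows "((\<lambda>y::real. max 0 y ^ Suc n) has_real_derivative real (Suc n) * max 0 y ^ n) (at y)"
proof -
  consider "y > 0" | "y < 0" | "y = 0" by linarith
  then show ?thesis
  proof cases
    case 1
    have "((\<lambda>y. y ^ Suc n) has_real_derivative real (Suc n) * max 0 y ^ n) (at y)"
      using DERIV_pow[of "Suc n" y] 1 by (simp add: max_def)
    moreover have "eventually (\<lambda>z. z \<in> {0<..}) (nhds y)"
      using 1 by (intro eventually_nhds_in_open) auto
    then have "eventually (\<lambda>z. z ^ Suc n = max 0 z ^ Suc n) (nhds y)"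
      by eventually_elim auto
    ultimately show ?thesis
      using DERIV_cong_ev[OF refl, of "\<lambda>z. z ^ Suc n" "\<lambda>z. max 0 z ^ Suc n" y] by blast
  next
    case 2
    have "((\<lambda>y. 0) has_real_derivative real (Suc n) * max 0 y ^ n) (at y)"
      using 2 assms by (auto simp: max_def power_0_left)
    moreover have "eventually (\<lambda>z. z \<in> {..<0}) (nhds y)"
      using 2 by (intro eventually_nhds_in_open) auto
    then have "eventually (\<lambda>z. 0 = max 0 z ^ Suc n) (nhds y)"
      by eventually_elim (auto simp: max_def)
    ultimately show ?thesis
      using DERIV_cong_ev[OF refl, of "\<lambda>z. 0" "\<lambda>z. max 0 z ^ Suc n" y] by blast
  next
    case 3
    \<comment> \<open>At the kink the difference quotient is at most
      \<open>\<bar>h\<bar> ^ n\<close>, which tends to 0 because n \<ge> 1.\<close>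
    have "((\<lambda>h::real. max 0 h ^ Suc n / h) \<longlongrightarrow> 0) (at 0)"
    proof (rule Lim_null_comparison)
      show "\<forall>\<^sub>F h::real in at 0. norm (max 0 h ^ Suc n / h) \<le> \<bar>h\<bar> ^ n"
        by (rule always_eventually) (auto simp: max_def)
      have "((\<lambda>h::real. \<bar>h\<bar> ^ n) \<longlongrightarrow> \<bar>0\<bar> ^ n) (at 0)" by (intro tendsto_intros)
      then show "((\<lambda>h::real. \<bar>h\<bar> ^ n) \<longlongrightarrow> 0) (at 0)" using assms by (simp add: power_0_left)
    qed
    moreover have "(\<lambda>h::real. (max 0 (0 + h) ^ Suc n - max 0 0 ^ Suc n) / h) = (\<lambda>h. max 0 h ^ Suc n / h)"
      by (rule ext) simp
    ultimately show ?thesis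
      using 3 assms unfolding DERIV_def by (simp add: power_0_left del: power_Suc)
  qed
qed

text \<open>Each differentiation lowers the power of the positive part by one. The cube is the least
  integer power whose second derivative still carries a continuous factor \<open>max 0 (v x)\<close>
  for every v.\<close>

lemma C2_pos_part_cube:
  fixes v :: "real \<Rightarrow> real"
  assumes "C2 v"
  shows "C2 (\<lambda>x. max 0 (v x) ^ 3)"
proof -
  obtain v1 v2 where v: "has_C2_derivs v v1 v2" using assms unfolding C2_def by blast
  then have d: "(v has_real_derivative v1 x) (at x)" "(v1 has_real_derivative v2 x) (at x)" for x
    unfolding has_C2_derivs_def has_real_derivative_iff_has_vector_derivative by auto
  have d1: "((\<lambda>x. max 0 (v x) ^ 3) has_real_derivative 3 * max 0 (v x) ^ 2 * v1 x) (at x)" for x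
    using DERIV_chain2[OF has_real_derivative_pos_part_power[of 2 "v x"] d(1)]
    by (simp add: eval_nat_numeral)
  have d2: "((\<lambda>x. max 0 (v x) ^ 2) has_real_derivative 2 * max 0 (v x) * v1 x) (at x)" for x
    using DERIV_chain2[OF has_real_derivative_pos_part_power[of 1 "v x"] d(1)]
    by (simp add: eval_nat_numeral)
  have "has_C2_derivs (\<lambda>x. max 0 (v x) ^ 3) (\<lambda>x. 3 * max 0 (v x) ^ 2 * v1 x)
      (\<lambda>x. 3 * (2 * max 0 (v x) * v1 x) * v1 x + 3 * max 0 (v x) ^ 2 * v2 x)"
    unfolding has_C2_derivs_def has_real_derivative_iff_has_vector_derivative[symmetric]
  proof (intro conjI allI)
    fix x
    show "((\<lambda>x. 3 * max 0 (v x) ^ 2 * v1 x) has_real_derivative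
        3 * (2 * max 0 (v x) * v1 x) * v1 x + 3 * max 0 (v x) ^ 2 * v2 x) (at x)"
      by (rule derivative_eq_intros d d2 refl)+ (simp add: algebra_simps)
  qed (intro d1 continuous_intros has_C2_derivs_continuous[OF v])+
  then show ?thesis unfolding C2_def by blast
qed

text \<open>A polynomial cutoff suffices since only two derivatives are ever used. Its homogeneity,
  \<open>bump r x = r^6 * bump 1 (x / r)\<close> for r > 0, later turns the cutoffs of growing
  radius into dilates of a single kernel.\<close>

definition bump :: "real \<Rightarrow> real \<Rightarrow> real" where
  "bump r x = max 0 (r\<^sup>2 - x\<^sup>2) ^ 3"

lemma C2_power2: "C2 (\<lambda>x::real. x\<^sup>2)"
proof -
  have "has_C2_derivs (\<lambda>x::real. x\<^sup>2) (\<lambda>x. 2 * x) (\<lambda>x. 2)"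
    unfolding has_C2_derivs_def has_real_derivative_iff_has_vector_derivative[symmetric]
    by (auto intro!: derivative_eq_intros)
  then show ?thesis unfolding C2_def by blast
qed

lemma C2_bump: "C2 (bump r)"
proof -
  have "C2 (\<lambda>x. r\<^sup>2 + (-1) * x\<^sup>2)" by (intro C2_add C2_mult C2_const C2_power2)
  from C2_pos_part_cube[OF this] show ?thesis by (simp add: bump_def[abs_def])
qed

text \<open>The counterpart of \<open>bump\<close>: it vanishes for \<bar>x\<bar> \<le>
  \<bar>r\<bar> and is positive beyond, so it can remove the zeros of a denominator outside an
  interval without changing it inside.\<close>

lemma C2_outer_bump: "C2 (\<lambda>x. max 0 (x\<^sup>2 - r\<^sup>2) ^ 3 :: real)"
proof -
  have "C2 (\<lambda>x. x\<^sup>2 + - (r\<^sup>2))" by (intro C2_add C2_const C2_power2)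
  from C2_pos_part_cube[OF this] show ?thesis by simp
qed

lemma bump_nonneg: "bump r x \<ge> 0"
  by (simp add: bump_def)

lemma bump_pos: "\<bar>x\<bar> < r \<Longrightarrow> bump r x > 0"
  using power_strict_mono[of "\<bar>x\<bar>" r 2] by (simp add: bump_def)

lemma bump_outside: "r \<ge> 0 \<Longrightarrow> \<bar>x\<bar> \<ge> r \<Longrightarrow> bump r x = 0"
  using power_mono[of r "\<bar>x\<bar>" 2] by (auto simp: bump_def max_def)

section \<open>Approximation by exponential sums in \<open>C\<^sup>2\<close>\<close>

text \<open>The factor with exponent k makes this the k-th derivative of the sum with k = 0, so one
  family covers all orders of differentiation.\<close>

definition exp_sum :: "real set \<Rightarrow> (real \<Rightarrow> complex) \<Rightarrow> nat \<Rightarrow> real \<Rightarrow> complex" where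
  "exp_sum F c k x = (\<Sum>l\<in>F. c l * (\<i> * of_real l) ^ k * exp (\<i> * complex_of_real (l * x)))"

lemma has_vector_derivative_exp_ii:
  "((\<lambda>x. exp (\<i> * complex_of_real (l * x))) has_vector_derivative
     \<i> * of_real l * exp (\<i> * complex_of_real (l * x))) (at x)"
proof -
  have "((\<lambda>z. exp (\<i> * of_real l * z)) has_field_derivative
      exp (\<i> * of_real l * complex_of_real x) * (\<i> * of_real l)) (at (complex_of_real x))"
    by (auto intro!: derivative_eq_intros)
  from has_vector_derivative_real_field[OF this]
  show ?thesis by (simp add: o_def mult_ac)
qed

lemma has_vector_derivative_exp_sum:
  "(exp_sum F c k has_vector_derivative exp_sum F c (Suc k) x) (at x)"
proof -
  have "((\<lambda>x. \<Sum>l\<in>F. c l * (\<i> * of_real l) ^ k * exp (\<i> * complex_of_real (l * x)))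
    has_vector_derivative (\<Sum>l\<in>F. c l * (\<i> * of_real l) ^ k *
      (\<i> * of_real l * exp (\<i> * complex_of_real (l * x))))) (at x)"
    by (intro has_vector_derivative_sum has_vector_derivative_mult_right has_vector_derivative_exp_ii)
  then show ?thesis by (simp add: exp_sum_def[abs_def] mult_ac)
qed

lemma has_C2_derivs_exp_sum:
  "has_C2_derivs (exp_sum F c 0) (exp_sum F c 1) (exp_sum F c 2)"
proof -
  have "continuous_on UNIV (exp_sum F c 2)"
    unfolding exp_sum_def by (intro continuous_intros)
  then show ?thesis
    using has_vector_derivative_exp_sum[of F c 0] has_vector_derivative_exp_sum[of F c 1]
    by (simp add: has_C2_derivs_def numeral_2_eq_2)
qed

lemma antiderivative_UNIV:
  fixes f :: "real \<Rightarrow> complex"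
  assumes "continuous_on UNIV f"
  obtains F where "\<And>x. (F has_vector_derivative f x) (at x)"
proof
  fix x :: real
  \<comment> \<open>The interval contains the base point 0 and has x in its interior, which makes
    the one-interval derivative two-sided.\<close>
  let ?a = "- \<bar>x\<bar> - 1" and ?b = "\<bar>x\<bar> + 1"
  have "((\<lambda>u. LBINT y=ereal 0..u. f y) has_vector_derivative f x) (at x within {?a..?b})"
    by (rule interval_integral_FTC2[of ?a 0 ?b f x])
       (use assms in \<open>auto intro: continuous_on_subset\<close>)
  moreover have "at x within {?a..?b} = at x"
    by (rule at_within_interior) auto
  ultimately show "((\<lambda>u. LBINT y=ereal 0..u. f y) has_vector_derivative f x) (at x)" by simp
qed

section \<open>Mean value estimates and second difference quotients\<close>

lemma vector_derivative_increment_bound: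
  fixes g :: "real \<Rightarrow> complex"
  assumes "a \<le> b" and d: "\<And>y. (g has_vector_derivative g' y) (at y)"
    and B: "\<And>y. a \<le> y \<Longrightarrow> y \<le> b \<Longrightarrow> norm (g' y) \<le> B"
  shows "norm (g b - g a) \<le> B * (b - a)"
proof (cases "a = b")
  case False
  with \<open>a \<le> b\<close> have "a < b" by simp
  have "continuous_on {a..b} g"
    using d by (auto intro!: continuous_at_imp_continuous_on has_vector_derivative_continuous)
  then obtain y where y: "y \<in> {a<..<b}" "norm (g b - g a) \<le> norm ((b - a) *\<^sub>R g' y)"
    using mvt_general[OF \<open>a < b\<close>, of g "\<lambda>y h. h *\<^sub>R g' y"] d
    unfolding has_vector_derivative_def by blast
  have "norm ((b - a) *\<^sub>R g' y) \<le> B * (b - a)"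
    using B[of y] y(1) \<open>a < b\<close> by (simp add: mult.commute mult_right_mono)
  with y(2) show ?thesis by simp
qed simp

text \<open>If V'' = u, this is the mean of u over \<open>[x, x + 2 \<eta>]\<close> against a
  triangular weight of total mass one, so bounds on u over that interval pass to it without
  loss.\<close>

definition second_diff :: "real \<Rightarrow> (real \<Rightarrow> complex) \<Rightarrow> real \<Rightarrow> complex" where
  "second_diff \<eta> V x = (V (x + 2 * \<eta>) - 2 * V (x + \<eta>) + V x) / of_real (\<eta>\<^sup>2)"

lemma second_diff_diff: "second_diff \<eta> (\<lambda>x. V x - W x) x = second_diff \<eta> V x - second_diff \<eta> W x"
  by (simp add: second_diff_def diff_divide_distrib[symmetric] algebra_simps)

lemma has_vector_derivative_shift_arg:
  fixes g :: "real \<Rightarrow> complex"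
  assumes "\<And>y. (g has_vector_derivative g' y) (at y)"
  shows "((\<lambda>y. g (y + s)) has_vector_derivative g' (y + s)) (at y)"
proof -
  have "((\<lambda>y. y + s) has_vector_derivative 1) (at y)"
    by (auto intro!: derivative_eq_intros)
  from vector_diff_chain_at[OF this assms[of "y + s"]] show ?thesis by (simp add: o_def)
qed

text \<open>Mean value inequality for \<open>U z - z * a\<close>, whose derivative is
  \<open>u z - a\<close>.\<close>

lemma first_diff_close:
  fixes U :: "real \<Rightarrow> complex"
  assumes \<eta>: "\<eta> > 0" and U: "\<And>y. (U has_vector_derivative u y) (at y)"
    and close: "\<And>y. x \<le> y \<Longrightarrow> y \<le> x + \<eta> \<Longrightarrow> norm (u y - a) \<le> \<epsilon>"
  shows "norm (U (x + \<eta>) - U x - of_real \<eta> * a) \<le> \<epsilon> * \<eta>"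
proof -
  have "((\<lambda>z. U z - of_real z * a) has_vector_derivative u z - of_real 1 * a) (at z)" for z
    by (intro has_vector_derivative_diff U
        has_vector_derivative_mult_left has_vector_derivative_of_real DERIV_ident)
  from vector_derivative_increment_bound[OF _ this, of x "x + \<eta>" \<epsilon>] \<eta> close
  show ?thesis by (simp add: algebra_simps)
qed

text \<open>A second difference is a first difference of first differences. Using the first-order
  estimate twice gains a factor \<eta> each time, which cancels the denominator.\<close>

lemma second_diff_close:
  assumes \<eta>: "\<eta> > 0" and V: "\<And>y. (V has_vector_derivative U y) (at y)"
    and U: "\<And>y. (U has_vector_derivative u y) (at y)"
    and close: "\<And>y. x \<le> y \<Longrightarrow> y \<le> x + 2 * \<eta> \<Longrightarrow> norm (u y - a) \<le> \<epsilon>"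
  shows "norm (second_diff \<eta> V x - a) \<le> \<epsilon>"
proof -
  let ?V = "\<lambda>y. V (y + \<eta>) - V y" and ?U = "\<lambda>y. U (y + \<eta>) - U y"
  have "norm (?U y - of_real \<eta> * a) \<le> \<epsilon> * \<eta>" if "x \<le> y" "y \<le> x + \<eta>" for y
    by (rule first_diff_close[OF \<eta> U]) (use that close in auto)
  moreover have "(?V has_vector_derivative ?U y) (at y)" for y
    by (intro has_vector_derivative_diff V has_vector_derivative_shift_arg)
  ultimately have "norm (?V (x + \<eta>) - ?V x - of_real \<eta> * (of_real \<eta> * a)) \<le> (\<epsilon> * \<eta>) * \<eta>"
    using first_diff_close[OF \<eta>, of ?V ?U x "of_real \<eta> * a" "\<epsilon> * \<eta>"] by blast
  moreover have "?V (x + \<eta>) - ?V x - of_real \<eta> * (of_real \<eta> * a)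
      = of_real (\<eta>\<^sup>2) * (second_diff \<eta> V x - a)"
    using \<eta> by (simp add: second_diff_def field_simps power2_eq_square)
  ultimately have "\<eta>\<^sup>2 * norm (second_diff \<eta> V x - a) \<le> \<eta>\<^sup>2 * \<epsilon>"
    using \<eta> by (simp add: norm_mult power2_eq_square mult_ac norm_power)
  then show ?thesis using \<eta> by simp
qed

text \<open>A second difference quotient, applied to a second antiderivative, acts as a mollifier that maps
  exponential sums to exponential sums; it upgrades uniform to \<open>C\<^sup>2\<close> approximation.\<close>

lemma second_diff_exp_antiderivative:
  assumes \<eta>: "\<eta> > 0"
  obtains V U m where "\<And>x. (V has_vector_derivative U x) (at x)"
    "\<And>x. (U has_vector_derivative exp_sum F c 0 x) (at x)"
    "\<And>x. second_diff \<eta> V x = exp_sum F (\<lambda>l. m l * c l) 0 x"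
    "\<And>x. second_diff \<eta> U x = exp_sum F (\<lambda>l. m l * c l) 1 x"
    "\<And>x. second_diff \<eta> (exp_sum F c 0) x = exp_sum F (\<lambda>l. m l * c l) 2 x"
proof -
  define e where "e l x = exp (\<i> * complex_of_real (l * x))" for l x :: real
  define d where "d l = \<i> * complex_of_real l" for l
  \<comment> \<open>First and second antiderivatives of the exponential. Frequency 0 is separate
    because there one cannot divide by \<open>d l\<close>; the constant 1 integrates to x and
    \<open>x^2 / 2\<close>.\<close>
  define u where "u l x = (if l = 0 then of_real x else e l x / d l)" for l x
  define v where "v l x = (if l = 0 then of_real (x\<^sup>2 / 2) else e l x / (d l)\<^sup>2)" for l x
  \<comment> \<open>The second difference multiplies \<open>e l\<close> by
    \<open>((e l \<eta> - 1) / \<eta>)^2\<close>, and two integrations divide by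
    \<open>(d l)^2\<close>. The value 1 is the limit as l tends to 0. The same multiplier serves all
    three orders of differentiation.\<close>
  define m where "m l = (if l = 0 then 1 else ((e l \<eta> - 1) / (d l * of_real \<eta>))\<^sup>2)" for l
  have e0: "e 0 x = 1" for x by (simp add: e_def)
  have d0: "d l = 0 \<longleftrightarrow> l = 0" for l by (simp add: d_def)
  have e_add: "e l (x + y) = e l x * e l y" for l x y
    by (simp add: e_def exp_add[symmetric] algebra_simps)
  have De: "(e l has_vector_derivative d l * e l x) (at x)" for l x
    unfolding e_def d_def by (rule has_vector_derivative_exp_ii)
  have Du: "(u l has_vector_derivative e l x) (at x)" for l x
  proof (cases "l = 0")
    case True
    have "((\<lambda>x. complex_of_real x) has_vector_derivative of_real 1) (at x)"
      by (intro has_vector_derivative_of_real DERIV_ident)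
    then show ?thesis using True by (simp add: u_def[abs_def] e0)
  next
    case False
    then show ?thesis
      using has_vector_derivative_divide[OF De[of l x], of "d l"] d0 by (simp add: u_def[abs_def])
  qed
  have Dv: "(v l has_vector_derivative u l x) (at x)" for l x
  proof (cases "l = 0")
    case True
    have "((\<lambda>x. x\<^sup>2 / 2) has_real_derivative x) (at x)" by (auto intro!: derivative_eq_intros)
    from has_vector_derivative_of_real[OF this, where 'a = complex] show ?thesis
      using True by (simp add: v_def[abs_def] u_def)
  next
    case False
    then show ?thesis
      using has_vector_derivative_divide[OF De[of l x], of "(d l)\<^sup>2"] d0
      by (simp add: v_def[abs_def] u_def power2_eq_square)
  qed
  have e2: "e l (x + 2 * \<eta>) = e l x * (e l \<eta>)\<^sup>2" for l x
    using e_add[of l x "\<eta> + \<eta>"] e_add[of l \<eta> \<eta>] by (simp add: power2_eq_square)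
  have e2': "e l (\<eta> * 2) = e l \<eta> * e l \<eta>" for l
    using e_add[of l \<eta> \<eta>] by (simp add: mult.commute)
  have Sv: "second_diff \<eta> (v l) x = m l * e l x" for l x
    using \<eta> d0[of l] by (cases "l = 0")
      (simp_all add: second_diff_def v_def m_def e2 e2' e0 e_add field_simps power2_eq_square)
  have Su: "second_diff \<eta> (u l) x = m l * d l * e l x" for l x
    using \<eta> d0[of l] by (cases "l = 0")
      (simp_all add: second_diff_def u_def m_def e2 e2' e0 e_add field_simps power2_eq_square)
  have Se: "second_diff \<eta> (e l) x = m l * (d l)\<^sup>2 * e l x" for l x
    using \<eta> d0[of l] by (cases "l = 0")
      (simp_all add: second_diff_def m_def e2 e2' e0 e_add field_simps power2_eq_square)
  have lin: "second_diff \<eta> (\<lambda>x. \<Sum>l\<in>F. c l * f l x) x = (\<Sum>l\<in>F. c l * second_diff \<eta> (f l) x)" for f x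
    by (simp add: second_diff_def sum_subtractf sum.distrib sum_distrib_left sum_divide_distrib
        algebra_simps add_divide_distrib diff_divide_distrib)
  have es: "exp_sum F c k x = (\<Sum>l\<in>F. c l * (d l) ^ k * e l x)" for k x and c
    by (simp add: exp_sum_def e_def d_def)
  show thesis
  proof (rule that[of "\<lambda>x. \<Sum>l\<in>F. c l * v l x" "\<lambda>x. \<Sum>l\<in>F. c l * u l x" m])
    fix x
    show "((\<lambda>x. \<Sum>l\<in>F. c l * v l x) has_vector_derivative (\<Sum>l\<in>F. c l * u l x)) (at x)"
      by (intro has_vector_derivative_sum has_vector_derivative_mult_right Dv)
    show "((\<lambda>x. \<Sum>l\<in>F. c l * u l x) has_vector_derivative exp_sum F c 0 x) (at x)"
      unfolding es by simp (intro has_vector_derivative_sum has_vector_derivative_mult_right Du)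
    show "second_diff \<eta> (\<lambda>x. \<Sum>l\<in>F. c l * v l x) x = exp_sum F (\<lambda>l. m l * c l) 0 x"
      by (simp add: lin Sv es mult_ac)
    show "second_diff \<eta> (\<lambda>x. \<Sum>l\<in>F. c l * u l x) x = exp_sum F (\<lambda>l. m l * c l) 1 x"
      by (simp add: lin Su es mult_ac)
    have "exp_sum F c 0 = (\<lambda>x. \<Sum>l\<in>F. c l * e l x)" by (simp add: es fun_eq_iff)
    then show "second_diff \<eta> (exp_sum F c 0) x = exp_sum F (\<lambda>l. m l * c l) 2 x"
      by (simp add: lin Se es mult_ac)
  qed
qed

text \<open>Fix the step \<eta> first, by uniform continuity of H, H1 and H2, so that mollifying
  moves each of them by at most \<epsilon>/2. Then approximate H uniformly to within a multiple of
  \<open>\<epsilon> * \<eta>^2\<close>; mollifying that error and differentiating up to twice loses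
  at most a factor of order \<open>1 / \<eta>^2\<close>. The quotient acts on V, U and H for the
  orders 0, 1 and 2.\<close>

lemma exp_complete_C2:
  assumes complete: "\<forall>\<rho>>0. exp_complete \<Lambda> \<rho>"
    and H: "has_C2_derivs H H1 H2" and "\<rho> > 0" "\<epsilon> > 0"
  obtains F c where "finite F" "F \<subseteq> \<Lambda>"
    "\<And>x. \<bar>x\<bar> \<le> \<rho> \<Longrightarrow> norm (H x - exp_sum F c 0 x) \<le> \<epsilon>"
    "\<And>x. \<bar>x\<bar> \<le> \<rho> \<Longrightarrow> norm (H1 x - exp_sum F c 1 x) \<le> \<epsilon>"
    "\<And>x. \<bar>x\<bar> \<le> \<rho> \<Longrightarrow> norm (H2 x - exp_sum F c 2 x) \<le> \<epsilon>"
proof -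
  \<comment> \<open>The quotient at x reads values up to \<open>x + 2 * \<eta>\<close> with \<eta> <
    1, so the approximation is taken on an interval longer by 2.\<close>
  define r where "r = \<rho> + 2"
  have "r > 0" using \<open>\<rho> > 0\<close> by (simp add: r_def)
  have unif: "\<exists>\<eta>>0. \<forall>x y. \<bar>x\<bar> \<le> r \<longrightarrow> \<bar>y\<bar> \<le> r \<longrightarrow> \<bar>y - x\<bar> < \<eta> \<longrightarrow> norm (f y - f x) \<le> \<epsilon> / 2"
    if "continuous_on {-r..r} f" for f :: "real \<Rightarrow> complex"
  proof -
    have "uniformly_continuous_on {-r..r} f"
      by (rule compact_uniformly_continuous) (use that in auto)
    then obtain \<eta> where "\<eta> > 0" "\<forall>x\<in>{-r..r}. \<forall>x'\<in>{-r..r}. dist x' x < \<eta> \<longrightarrow> dist (f x') (f x) < \<epsilon> / 2"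
      unfolding uniformly_continuous_on_def using \<open>\<epsilon> > 0\<close> by (meson half_gt_zero)
    then show ?thesis
      by (intro exI[of _ \<eta>]) (auto simp: dist_norm abs_le_iff intro!: less_imp_le)
  qed
  note cont = has_C2_derivs_continuous[OF H]
  obtain \<eta>0 where \<eta>0: "\<eta>0 > 0"
    "\<And>x y. \<bar>x\<bar> \<le> r \<Longrightarrow> \<bar>y\<bar> \<le> r \<Longrightarrow> \<bar>y - x\<bar> < \<eta>0 \<Longrightarrow> norm (H y - H x) \<le> \<epsilon> / 2"
    using unif[OF cont(1)] by blast
  obtain \<eta>1 where \<eta>1: "\<eta>1 > 0"
    "\<And>x y. \<bar>x\<bar> \<le> r \<Longrightarrow> \<bar>y\<bar> \<le> r \<Longrightarrow> \<bar>y - x\<bar> < \<eta>1 \<Longrightarrow> norm (H1 y - H1 x) \<le> \<epsilon> / 2"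
    using unif[OF cont(2)] by blast
  obtain \<eta>2 where \<eta>2: "\<eta>2 > 0"
    "\<And>x y. \<bar>x\<bar> \<le> r \<Longrightarrow> \<bar>y\<bar> \<le> r \<Longrightarrow> \<bar>y - x\<bar> < \<eta>2 \<Longrightarrow> norm (H2 y - H2 x) \<le> \<epsilon> / 2"
    using unif[OF cont(3)] by blast
  note \<eta>012 = \<eta>0(1) \<eta>1(1) \<eta>2(1) \<eta>0(2) \<eta>1(2) \<eta>2(2)
  define \<eta> where "\<eta> = min 1 (min \<eta>0 (min \<eta>1 \<eta>2)) / 4"
  have \<eta>: "\<eta> > 0" "\<eta> < 1" "2 * \<eta> < \<eta>0" "2 * \<eta> < \<eta>1" "2 * \<eta> < \<eta>2"
    using \<eta>012(1-3) by (auto simp: \<eta>_def min_def)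
  have osc: "norm (H y - H x) \<le> \<epsilon> / 2" "norm (H1 y - H1 x) \<le> \<epsilon> / 2" "norm (H2 y - H2 x) \<le> \<epsilon> / 2"
    if "\<bar>x\<bar> \<le> \<rho>" "x \<le> y" "y \<le> x + 2 * \<eta>" for x y
    using that \<eta> \<eta>012(4-6)[of x y] by (auto simp: r_def)
  \<comment> \<open>The worst case is order 2: the coefficients 1, -2, 1 have total size 4, and
    \<open>4 * \<delta> / \<eta>^2 = \<epsilon> / 2\<close>.\<close>
  define \<delta> where "\<delta> = \<epsilon> * \<eta>\<^sup>2 / 8"
  have "\<delta> > 0" using \<eta> \<open>\<epsilon> > 0\<close> by (simp add: \<delta>_def)
  obtain F c where F: "finite F" "F \<subseteq> \<Lambda>"
    and Fc: "\<forall>x\<in>{-r..r}. norm (H x - (\<Sum>l\<in>F. c l * exp (\<i> * complex_of_real (l * x)))) < \<delta>"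
    using complete[rule_format, OF \<open>r > 0\<close>] cont(1) \<open>\<delta> > 0\<close> unfolding exp_complete_def by meson
  let ?e = "\<lambda>x. H x - exp_sum F c 0 x"
  have e: "norm (?e x) \<le> \<delta>" if "\<bar>x\<bar> \<le> r" for x
    using Fc[rule_format, of x] that by (simp add: exp_sum_def abs_le_iff)
  obtain VG UG m where G: "\<And>x. (VG has_vector_derivative UG x) (at x)"
    "\<And>x. (UG has_vector_derivative exp_sum F c 0 x) (at x)"
    "\<And>x. second_diff \<eta> VG x = exp_sum F (\<lambda>l. m l * c l) 0 x"
    "\<And>x. second_diff \<eta> UG x = exp_sum F (\<lambda>l. m l * c l) 1 x"
    "\<And>x. second_diff \<eta> (exp_sum F c 0) x = exp_sum F (\<lambda>l. m l * c l) 2 x"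
    by (rule second_diff_exp_antiderivative[OF \<eta>(1), of F c]; rule that; assumption)
  have H': "(H has_vector_derivative H1 x) (at x)" "(H1 has_vector_derivative H2 x) (at x)" for x
    using H by (auto simp: has_C2_derivs_def)
  obtain U where U: "\<And>x. (U has_vector_derivative H x) (at x)"
    using antiderivative_UNIV cont(1) by blast
  have "continuous_on UNIV U"
    using U by (auto intro!: continuous_at_imp_continuous_on has_vector_derivative_continuous)
  then obtain V where V: "\<And>x. (V has_vector_derivative U x) (at x)"
    using antiderivative_UNIV by blast
  have DW: "((\<lambda>x. V x - VG x) has_vector_derivative U x - UG x) (at x)"
    "((\<lambda>x. U x - UG x) has_vector_derivative ?e x) (at x)" for x
    by (intro has_vector_derivative_diff U V G)+
  have \<delta>1: "4 * \<delta> / \<eta>\<^sup>2 = \<epsilon> / 2" using \<eta> by (simp add: \<delta>_def)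
  have "\<eta>\<^sup>2 \<le> \<eta>" using \<eta> by (simp add: power2_eq_square mult_left_le)
  then have \<delta>2: "\<delta> \<le> \<epsilon> / 2" "2 * \<delta> * \<eta> / \<eta>\<^sup>2 \<le> \<epsilon> / 2"
    using \<eta> \<open>\<epsilon> > 0\<close> by (simp_all add: \<delta>_def field_simps)
  show thesis
  proof (rule that[OF F, of "\<lambda>l. m l * c l"])
    fix x assume x: "\<bar>x\<bar> \<le> \<rho>"
    have xr: "\<bar>y\<bar> \<le> r" if "x \<le> y" "y \<le> x + 2 * \<eta>" for y
      using that x \<eta> by (simp add: r_def)
    have "norm (second_diff \<eta> V x - H x) \<le> \<epsilon> / 2"
      by (rule second_diff_close[OF \<eta>(1) V U osc(1)[OF x]])
    moreover have "norm (second_diff \<eta> (\<lambda>x. V x - VG x) x - 0) \<le> \<delta>"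
      by (rule second_diff_close[OF \<eta>(1) DW]) (simp add: e xr)
    ultimately show "norm (H x - exp_sum F (\<lambda>l. m l * c l) 0 x) \<le> \<epsilon>"
      using norm_triangle_ineq4[of "second_diff \<eta> (\<lambda>x. V x - VG x) x" "second_diff \<eta> V x - H x"] \<delta>2(1)
      by (simp add: second_diff_diff G(3))
    have "norm (second_diff \<eta> U x - H1 x) \<le> \<epsilon> / 2"
      by (rule second_diff_close[OF \<eta>(1) U H'(1) osc(2)[OF x]])
    moreover have "norm (second_diff \<eta> (\<lambda>x. U x - UG x) x) \<le> \<epsilon> / 2"
    proof -
      let ?W = "\<lambda>x. U x - UG x"
      \<comment> \<open>The second difference of the integrated error is a difference of two
        increments, each at most \<open>\<delta> * \<eta>\<close>; only one power of \<eta> is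
        lost.\<close>
      have "norm (?W (x + \<eta> + \<eta>) - ?W (x + \<eta>)) \<le> \<delta> * (x + \<eta> + \<eta> - (x + \<eta>))"
        by (rule vector_derivative_increment_bound[OF _ DW(2)]) (use e xr \<eta>(1) in auto)
      moreover have "norm (?W (x + \<eta>) - ?W x) \<le> \<delta> * (x + \<eta> - x)"
        by (rule vector_derivative_increment_bound[OF _ DW(2)]) (use e xr \<eta>(1) in auto)
      ultimately have "norm (?W (x + 2 * \<eta>) - 2 * ?W (x + \<eta>) + ?W x) \<le> 2 * \<delta> * \<eta>"
        using norm_triangle_ineq4[of "?W (x + \<eta> + \<eta>) - ?W (x + \<eta>)" "?W (x + \<eta>) - ?W x"]
        by (simp add: algebra_simps)
      then have "norm (second_diff \<eta> ?W x) \<le> 2 * \<delta> * \<eta> / \<eta>\<^sup>2"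
        unfolding second_diff_def norm_divide norm_of_real by (intro divide_mono) (use \<eta> in auto)
      then show ?thesis using \<delta>2(2) by simp
    qed
    ultimately show "norm (H1 x - exp_sum F (\<lambda>l. m l * c l) 1 x) \<le> \<epsilon>"
      using norm_triangle_ineq4[of "second_diff \<eta> (\<lambda>x. U x - UG x) x" "second_diff \<eta> U x - H1 x"]
      by (simp add: second_diff_diff G(4))
    have "norm (second_diff \<eta> H x - H2 x) \<le> \<epsilon> / 2"
      by (rule second_diff_close[OF \<eta>(1) H' osc(3)[OF x]])
    moreover have "norm (second_diff \<eta> ?e x) \<le> \<epsilon> / 2"
    proof -
      have "norm (?e (x + 2 * \<eta>) - 2 * ?e (x + \<eta>) + ?e x)
          \<le> norm (?e (x + 2 * \<eta>)) + norm (2 * ?e (x + \<eta>)) + norm (?e x)"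
        by (meson norm_triangle_ineq norm_triangle_ineq4 add_mono order_refl order_trans)
      also have "\<dots> \<le> \<delta> + 2 * \<delta> + \<delta>"
        unfolding norm_mult norm_numeral by (intro add_mono mult_left_mono e xr) (use \<eta> in auto)
      finally have "norm (second_diff \<eta> ?e x) \<le> 4 * \<delta> / \<eta>\<^sup>2"
        unfolding second_diff_def norm_divide norm_of_real by (intro divide_mono) (use \<eta> in auto)
      then show ?thesis using \<delta>1 by simp
    qed
    ultimately show "norm (H2 x - exp_sum F (\<lambda>l. m l * c l) 2 x) \<le> \<epsilon>"
      using norm_triangle_ineq4[of "second_diff \<eta> ?e x" "second_diff \<eta> H x - H2 x"]
      by (simp add: second_diff_diff G(5))
  qed
qed

section \<open>Fourier transforms of compactly supported \<open>C\<^sup>2\<close> functions\<close>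

definition vanishes_beyond :: "real \<Rightarrow> (real \<Rightarrow> 'a::zero) \<Rightarrow> bool" where
  "vanishes_beyond r u \<longleftrightarrow> (\<forall>x. \<bar>x\<bar> \<ge> r \<longrightarrow> u x = 0)"

text \<open>With this sign, multiplying u by the exponential of frequency l translates
  \<open>ft u\<close> by l to the right; this is how exponential sums become combinations of
  translates.\<close>

definition ft :: "(real \<Rightarrow> complex) \<Rightarrow> real \<Rightarrow> complex" where
  "ft u t = (\<integral>x. u x * exp (- (\<i> * complex_of_real (t * x))) \<partial>lborel)"

lemma vanishes_beyond_mono: "vanishes_beyond r u \<Longrightarrow> r \<le> s \<Longrightarrow> vanishes_beyond s u"
  by (simp add: vanishes_beyond_def)

lemma vanishes_beyond_eq_indicator:
  fixes u :: "real \<Rightarrow> 'a::real_vector"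
  assumes "vanishes_beyond r u"
  shows "u = (\<lambda>x. indicator {-r..r} x *\<^sub>R u x)"
  using assms by (auto simp: vanishes_beyond_def fun_eq_iff indicator_def abs_le_iff)

lemma integrable_vanishes_beyond:
  fixes u :: "real \<Rightarrow> 'a::{banach, second_countable_topology}"
  assumes "continuous_on UNIV u" "vanishes_beyond r u"
  shows "integrable lborel u"
proof -
  have "integrable lborel (\<lambda>x. indicator {-r..r} x *\<^sub>R u x)"
    by (rule borel_integrable_compact) (use assms in \<open>auto intro: continuous_on_subset\<close>)
  then show ?thesis using vanishes_beyond_eq_indicator[OF assms(2)] by simp
qed

lemma norm_integral_vanishes_beyond_le:
  fixes u :: "real \<Rightarrow> 'a::{banach, second_countable_topology}"
  assumes u: "continuous_on UNIV u" "vanishes_beyond r u" and "r > 0"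
    and B: "\<And>x. \<bar>x\<bar> \<le> r \<Longrightarrow> norm (u x) \<le> B"
  shows "norm (\<integral>x. u x \<partial>lborel) \<le> 2 * r * B"
proof -
  have "B \<ge> 0" using B[of 0] \<open>r > 0\<close> norm_ge_zero[of "u 0"] by linarith
  have "norm (\<integral>x. u x \<partial>lborel) \<le> (\<integral>x. indicator {-r..r} x *\<^sub>R B \<partial>lborel)"
  proof (rule Bochner_Integration.integral_norm_bound_integral)
    show "integrable lborel (\<lambda>x. indicator {-r..r} x *\<^sub>R B)"
      by (simp add: integrable_indicator_iff emeasure_lborel_Icc_eq)
    show "norm (u x) \<le> indicator {-r..r} x *\<^sub>R B" for x
      using u(2) B[of x] by (auto simp: vanishes_beyond_def indicator_def abs_le_iff)
  qed (rule integrable_vanishes_beyond[OF u])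
  also have "\<dots> = 2 * r * B" using \<open>r > 0\<close> by simp
  finally show ?thesis .
qed

lemma ft_kernel_derivative:
  "((\<lambda>x. exp (- (\<i> * complex_of_real (t * x)))) has_vector_derivative
     - (\<i> * of_real t) * exp (- (\<i> * complex_of_real (t * x)))) (at x)"
  using has_vector_derivative_exp_ii[of "-t" x] by simp

text \<open>Two bounds are added: the trivial one for \<open>ft u t\<close>, and one for
  \<open>t^2 * ft u t\<close> from integrating by parts twice, where the boundary terms vanish. Each
  is at most \<open>2 * (r + 1) * A\<close>.\<close>

lemma ft_decay:
  assumes u: "has_C2_derivs u u1 u2" and v: "vanishes_beyond r u" and "r > 0"
    and A: "\<And>x. \<bar>x\<bar> \<le> r \<Longrightarrow> norm (u x) \<le> A" "\<And>x. \<bar>x\<bar> \<le> r \<Longrightarrow> norm (u2 x) \<le> A"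
  shows "norm (ft u t) \<le> 4 * (r + 1) * A / (1 + t\<^sup>2)"
proof -
  \<comment> \<open>Locality of the derivative gives u1 = u2 = 0 only for \<bar>x\<bar> > r; the
    larger radius avoids discussing the endpoints.\<close>
  define s where "s = r + 1"
  have "s > 0" using \<open>r > 0\<close> by (simp add: s_def)
  have "A \<ge> 0" using A(1)[of 0] \<open>r > 0\<close> norm_ge_zero[of "u 0"] by linarith
  have dz: "f' x = 0" if f: "\<And>x. (f has_vector_derivative f' x) (at x)" "\<And>x. \<bar>x\<bar> > r \<Longrightarrow> f x = 0"
    and x: "\<bar>x\<bar> > r" for f f' :: "real \<Rightarrow> complex" and x
  proof -
    have "((\<lambda>z. 0) has_vector_derivative f' x) (at x)"
      by (rule has_vector_derivative_transform_within_open[OF f(1), of "- {-r..r}"])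
         (use f(2) x in auto)
    then show ?thesis
      using vector_derivative_unique_at has_vector_derivative_const by blast
  qed
  have u': "\<And>x. (u has_vector_derivative u1 x) (at x)" "\<And>x. (u1 has_vector_derivative u2 x) (at x)"
    using u by (auto simp: has_C2_derivs_def)
  have u1z: "u1 x = 0" if "\<bar>x\<bar> > r" for x
    by (rule dz[OF u'(1) _ that]) (use v in \<open>simp add: vanishes_beyond_def\<close>)
  have u2z: "u2 x = 0" if "\<bar>x\<bar> > r" for x
    by (rule dz[OF u'(2) _ that]) (rule u1z)
  have v2: "vanishes_beyond s u2" using u2z by (simp add: vanishes_beyond_def s_def)
  let ?e = "\<lambda>x. exp (- (\<i> * complex_of_real (t * x)))"
  have e1: "norm (?e x) = 1" for x by (simp add: norm_exp_eq_Re)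
  have cont: "continuous_on UNIV (\<lambda>x. u x * ?e x)" "continuous_on UNIV (\<lambda>x. u2 x * ?e x)"
    by (intro continuous_intros has_C2_derivs_continuous[OF u])+
  have van: "vanishes_beyond s (\<lambda>x. u x * ?e x)" "vanishes_beyond s (\<lambda>x. u2 x * ?e x)"
    using v v2 by (auto simp: vanishes_beyond_def s_def)
  have int: "integrable lborel (\<lambda>x. u x * ?e x)" "integrable lborel (\<lambda>x. u2 x * ?e x)"
    using integrable_vanishes_beyond cont van by blast+
  have b1: "norm (ft u t) \<le> 2 * s * A"
    unfolding ft_def
  proof (rule norm_integral_vanishes_beyond_le[OF cont(1) van(1) \<open>s > 0\<close>])
    fix x show "norm (u x * ?e x) \<le> A"
      using A(1)[of x] v \<open>A \<ge> 0\<close> by (cases "\<bar>x\<bar> \<le> r") (auto simp: norm_mult e1 vanishes_beyond_def)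
  qed
  \<comment> \<open>Both integrations by parts at once: the mixed terms in the derivative of V
    cancel and leave \<open>(u2 + t^2 * u)\<close> times the kernel.\<close>
  define V where "V x = (u1 x + \<i> * of_real t * u x) * ?e x" for x
  have DV: "(V has_vector_derivative u2 x * ?e x + of_real (t\<^sup>2) * (u x * ?e x)) (at x)" for x
  proof -
    have "(V has_vector_derivative (u1 x + \<i> * of_real t * u x) * (- (\<i> * of_real t) * ?e x)
        + (u2 x + \<i> * of_real t * u1 x) * ?e x) (at x)"
      unfolding V_def
      by (intro has_vector_derivative_mult has_vector_derivative_add has_vector_derivative_mult_right
          u' ft_kernel_derivative)
    moreover have "(u1 x + \<i> * of_real t * u x) * (- (\<i> * of_real t) * ?e x)
        + (u2 x + \<i> * of_real t * u1 x) * ?e x = u2 x * ?e x + of_real (t\<^sup>2) * (u x * ?e x)"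
      by (simp add: algebra_simps power2_eq_square)
    ultimately show ?thesis by simp
  qed
  have "(\<integral>x. indicator {-s..s} x *\<^sub>R (u2 x * ?e x + of_real (t\<^sup>2) * (u x * ?e x)) \<partial>lborel) = V s - V (-s)"
  proof (rule integral_FTC_Icc)
    show "continuous_on {-s..s} (\<lambda>x. u2 x * ?e x + of_real (t\<^sup>2) * (u x * ?e x))"
      by (intro continuous_intros has_C2_derivs_continuous[OF u])
  qed (use \<open>s > 0\<close> has_vector_derivative_at_within[OF DV] in simp_all)
  also have "V s - V (-s) = 0"
    using u1z[of s] u1z[of "-s"] v \<open>r > 0\<close> by (simp add: V_def vanishes_beyond_def s_def)
  also have "(\<lambda>x. indicator {-s..s} x *\<^sub>R (u2 x * ?e x + of_real (t\<^sup>2) * (u x * ?e x)))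
      = (\<lambda>x. u2 x * ?e x + of_real (t\<^sup>2) * (u x * ?e x))"
    by (rule vanishes_beyond_eq_indicator[symmetric])
       (use van in \<open>simp add: vanishes_beyond_def\<close>)
  finally have "(\<integral>x. u2 x * ?e x \<partial>lborel) + of_real (t\<^sup>2) * ft u t = 0"
    using int by (simp add: ft_def)
  then have "norm (of_real (t\<^sup>2) * ft u t) = norm (\<integral>x. u2 x * ?e x \<partial>lborel)"
    by (metis add_eq_0_iff2 norm_minus_cancel)
  also have "\<dots> \<le> 2 * s * A"
  proof (rule norm_integral_vanishes_beyond_le[OF cont(2) van(2) \<open>s > 0\<close>])
    fix x show "norm (u2 x * ?e x) \<le> A"
      using A(2)[of x] u2z[of x] \<open>A \<ge> 0\<close> by (cases "\<bar>x\<bar> \<le> r") (auto simp: norm_mult e1)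
  qed
  finally have "norm (ft u t) * (1 + t\<^sup>2) \<le> 4 * (r + 1) * A"
    using b1 by (simp add: norm_mult s_def algebra_simps norm_power)
  moreover have "1 + t\<^sup>2 > 0" by (simp add: add_pos_nonneg)
  ultimately show ?thesis by (simp add: pos_le_divide_eq)
qed

lemma integrable_inverse_one_plus_square: "integrable lborel (\<lambda>t::real. 1 / (1 + t\<^sup>2))"
  and integral_inverse_one_plus_square: "(\<integral>t. 1 / (1 + t\<^sup>2) \<partial>lborel) = pi"
  using integrable_inverse_1_plus_square LBINT_inverse_1_plus_square
  by (simp_all add: set_integrable_def interval_lebesgue_integral_def set_lebesgue_integral_def
      inverse_eq_divide)

lemma ft_measurable [measurable]:
  assumes [measurable]: "u \<in> borel_measurable borel"
  shows "ft u \<in> borel_measurable borel"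
proof -
  have "(\<lambda>(t, x). u x * exp (- (\<i> * complex_of_real (t * x)))) \<in> borel_measurable (borel \<Otimes>\<^sub>M lborel)"
    by measurable
  then show ?thesis
    unfolding ft_def[abs_def] by (rule sigma_finite_measure.borel_measurable_lebesgue_integral[rotated])
      unfold_locales
qed

lemma
  assumes u: "has_C2_derivs u u1 u2" and v: "vanishes_beyond r u" and "r > 0"
    and A: "\<And>x. \<bar>x\<bar> \<le> r \<Longrightarrow> norm (u x) \<le> A" "\<And>x. \<bar>x\<bar> \<le> r \<Longrightarrow> norm (u2 x) \<le> A"
  shows integrable_ft_derivs: "integrable lborel (ft u)"
    and integral_norm_ft_le: "(\<integral>t. norm (ft u t) \<partial>lborel) \<le> 4 * pi * (r + 1) * A"
proof -
  have [measurable]: "u \<in> borel_measurable borel"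
    by (intro borel_measurable_continuous_onI has_C2_derivs_continuous[OF u])
  note decay = ft_decay[OF assms]
  have dom: "integrable lborel (\<lambda>t. 4 * (r + 1) * A / (1 + t\<^sup>2))"
    using integrable_mult_right[OF integrable_inverse_one_plus_square, of "4 * (r + 1) * A"] by simp
  show int: "integrable lborel (ft u)"
    by (rule Bochner_Integration.integrable_bound[OF dom])
       (use order_trans[OF decay abs_ge_self] in \<open>auto intro!: AE_I2 simp del: abs_divide\<close>)
  have "(\<integral>t. norm (ft u t) \<partial>lborel) \<le> (\<integral>t. 4 * (r + 1) * A / (1 + t\<^sup>2) \<partial>lborel)"
    by (rule integral_mono[OF integrable_norm[OF int] dom decay])
  also have "\<dots> = 4 * (r + 1) * A * (\<integral>t. 1 / (1 + t\<^sup>2) \<partial>lborel)"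
    by (subst integral_mult_right_zero[symmetric]) simp
  finally show "(\<integral>t. norm (ft u t) \<partial>lborel) \<le> 4 * pi * (r + 1) * A"
    by (simp add: integral_inverse_one_plus_square mult_ac)
qed

lemma continuous_bounded_on_segment:
  fixes f :: "real \<Rightarrow> 'a::real_normed_vector"
  assumes "continuous_on UNIV f"
  obtains A where "A \<ge> 0" "\<And>x. \<bar>x\<bar> \<le> r \<Longrightarrow> norm (f x) \<le> A"
proof -
  have "compact (f ` {-r..r})"
    by (intro compact_continuous_image continuous_on_subset[OF assms]) auto
  then obtain A where A: "A > 0" "\<forall>y\<in>f ` {-r..r}. norm y \<le> A"
    using compact_imp_bounded bounded_pos by blast
  then show thesis by (intro that[of A]) (auto simp: abs_le_iff)
qed

lemma integrable_ft:
  assumes "C2 u" "vanishes_beyond r u"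
  shows "integrable lborel (ft u)"
proof -
  obtain u1 u2 where u: "has_C2_derivs u u1 u2" using assms unfolding C2_def by blast
  \<comment> \<open>The decay estimate asks for a positive radius, while r is arbitrary
    here.\<close>
  have v: "vanishes_beyond (max r 1) u" using assms(2) by (rule vanishes_beyond_mono) simp
  obtain A1 where A1: "\<And>x. \<bar>x\<bar> \<le> max r 1 \<Longrightarrow> norm (u x) \<le> A1"
    using continuous_bounded_on_segment[OF has_C2_derivs_continuous(1)[OF u]] by blast
  obtain A2 where A2: "\<And>x. \<bar>x\<bar> \<le> max r 1 \<Longrightarrow> norm (u2 x) \<le> A2"
    using continuous_bounded_on_segment[OF has_C2_derivs_continuous(3)[OF u]] by blast
  show ?thesis
    by (rule integrable_ft_derivs[OF u v, of "max A1 A2"]) (auto intro: order_trans A1 A2)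
qed

lemma integrable_ft_integrand:
  fixes u :: "real \<Rightarrow> complex"
  assumes "integrable lborel u"
  shows "integrable lborel (\<lambda>x. u x * exp (- (\<i> * complex_of_real (t * x))))"
  by (rule Bochner_Integration.integrable_bound[OF assms])
     (use assms in \<open>auto simp: norm_mult norm_exp_eq_Re\<close>)

lemma ft_diff: "integrable lborel u \<Longrightarrow> integrable lborel v \<Longrightarrow> ft (\<lambda>x. u x - v x) t = ft u t - ft v t"
  unfolding ft_def left_diff_distrib
  by (intro Bochner_Integration.integral_diff integrable_ft_integrand)

lemma ft_add: "integrable lborel u \<Longrightarrow> integrable lborel v \<Longrightarrow> ft (\<lambda>x. u x + v x) t = ft u t + ft v t"
  unfolding ft_def distrib_right
  by (intro Bochner_Integration.integral_add integrable_ft_integrand)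

lemma ft_cmult: "ft (\<lambda>x. c * u x) t = c * ft u t"
  by (simp add: ft_def mult.assoc)

lemma ft_exp_sum:
  assumes "integrable lborel u"
  shows "ft (\<lambda>x. u x * exp_sum F c 0 x) t = (\<Sum>l\<in>F. c l * ft u (t - l))"
proof -
  have "u x * exp_sum F c 0 x * exp (- (\<i> * complex_of_real (t * x)))
      = (\<Sum>l\<in>F. c l * (u x * exp (- (\<i> * complex_of_real ((t - l) * x)))))" for x
    by (simp add: exp_sum_def sum_distrib_left sum_distrib_right algebra_simps exp_diff exp_minus
        divide_simps exp_add[symmetric])
  moreover have "integrable lborel (\<lambda>x. c l * (u x * exp (- (\<i> * complex_of_real ((t - l) * x)))))" for l
    by (intro integrable_mult_right integrable_ft_integrand assms)
  ultimately show ?thesis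
    by (simp add: ft_def Bochner_Integration.integral_sum del: of_real_mult of_real_diff)
qed

text \<open>If G is an exponential sum close to H in C2, then \<open>ft (\<Phi> G)\<close> is a
  combination of translates of \<open>ft \<Phi>\<close>, and the error \<open>\<Phi> (H - G)\<close>
  is small in C2 with fixed compact support, so its transform is small in L1.\<close>

lemma ft_mult_approx:
  assumes complete: "\<forall>\<rho>>0. exp_complete \<Lambda> \<rho>"
    and \<Phi>: "C2 \<Phi>" "vanishes_beyond r \<Phi>" and H: "C2 H" and "\<epsilon> > 0"
  obtains F c where "finite F" "F \<subseteq> \<Lambda>"
    "(\<integral>t. norm (ft (\<lambda>x. \<Phi> x * H x) t - (\<Sum>l\<in>F. c l * ft \<Phi> (t - l))) \<partial>lborel) < \<epsilon>"
proof -
  define s where "s = max r 1"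
  have "s > 0" and v: "vanishes_beyond s \<Phi>" using vanishes_beyond_mono[OF \<Phi>(2)] by (auto simp: s_def)
  obtain \<Phi>1 \<Phi>2 where d\<Phi>: "has_C2_derivs \<Phi> \<Phi>1 \<Phi>2" using \<Phi> unfolding C2_def by blast
  obtain H1 H2 where dH: "has_C2_derivs H H1 H2" using H unfolding C2_def by blast
  obtain A0 where A0: "A0 \<ge> 0" "\<And>x. \<bar>x\<bar> \<le> s \<Longrightarrow> norm (\<Phi> x) \<le> A0"
    using continuous_bounded_on_segment[OF has_C2_derivs_continuous(1)[OF d\<Phi>]] by blast
  obtain A1 where A1: "A1 \<ge> 0" "\<And>x. \<bar>x\<bar> \<le> s \<Longrightarrow> norm (\<Phi>1 x) \<le> A1"
    using continuous_bounded_on_segment[OF has_C2_derivs_continuous(2)[OF d\<Phi>]] by blast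
  obtain A2 where A2: "A2 \<ge> 0" "\<And>x. \<bar>x\<bar> \<le> s \<Longrightarrow> norm (\<Phi>2 x) \<le> A2"
    using continuous_bounded_on_segment[OF has_C2_derivs_continuous(3)[OF d\<Phi>]] by blast
  \<comment> \<open>The weights 1, 2, 1 come from the Leibniz rule for the second
    derivative.\<close>
  define A where "A = A0 + 2 * A1 + A2"
  \<comment> \<open>The summand 1 keeps C positive even if \<Phi> vanishes identically.\<close>
  define C where "C = 4 * pi * (s + 1) * (A + 1)"
  have "C > 0" using A0 A1 A2 \<open>s > 0\<close> by (simp add: C_def A_def)
  define \<delta> where "\<delta> = \<epsilon> / (2 * C)"
  have "\<delta> > 0" using \<open>\<epsilon> > 0\<close> \<open>C > 0\<close> by (simp add: \<delta>_def)
  obtain F c where F: "finite F" "F \<subseteq> \<Lambda>"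
    and G: "\<And>x. \<bar>x\<bar> \<le> s \<Longrightarrow> norm (H x - exp_sum F c 0 x) \<le> \<delta>"
    "\<And>x. \<bar>x\<bar> \<le> s \<Longrightarrow> norm (H1 x - exp_sum F c 1 x) \<le> \<delta>"
    "\<And>x. \<bar>x\<bar> \<le> s \<Longrightarrow> norm (H2 x - exp_sum F c 2 x) \<le> \<delta>"
    by (rule exp_complete_C2[OF complete dH \<open>s > 0\<close> \<open>\<delta> > 0\<close>]; rule that; assumption)
  let ?e = "\<lambda>k Hk x. Hk x - exp_sum F c k x"
  define w where "w x = \<Phi> x * ?e 0 H x" for x
  define w2 where "w2 x = \<Phi> x * ?e 2 H2 x + 2 * (\<Phi>1 x * ?e 1 H1 x) + \<Phi>2 x * ?e 0 H x" for x
  have dw: "has_C2_derivs w (\<lambda>x. \<Phi> x * ?e 1 H1 x + \<Phi>1 x * ?e 0 H x) w2"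
    unfolding w_def[abs_def] w2_def[abs_def]
    by (intro has_C2_derivs_mult has_C2_derivs_diff d\<Phi> dH has_C2_derivs_exp_sum)
  have vw: "vanishes_beyond s w" using v by (simp add: vanishes_beyond_def w_def)
  have "norm (w x) \<le> A * \<delta>" if "\<bar>x\<bar> \<le> s" for x
  proof -
    have "norm (w x) \<le> A0 * \<delta>"
      unfolding w_def norm_mult by (intro mult_mono A0 G that) auto
    also have "\<dots> \<le> A * \<delta>" using A1 A2 \<open>\<delta> > 0\<close> by (simp add: A_def)
    finally show ?thesis .
  qed
  moreover have "norm (w2 x) \<le> A * \<delta>" if "\<bar>x\<bar> \<le> s" for x
  proof -
    have "norm (w2 x) \<le> norm (\<Phi> x) * norm (?e 2 H2 x) + 2 * (norm (\<Phi>1 x) * norm (?e 1 H1 x))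
        + norm (\<Phi>2 x) * norm (?e 0 H x)"
      unfolding w2_def by (intro norm_triangle_le add_mono) (simp_all add: norm_mult)
    also have "\<dots> \<le> A0 * \<delta> + 2 * (A1 * \<delta>) + A2 * \<delta>"
      by (intro add_mono mult_mono A0 A1 A2 G that order_refl) (use \<open>\<delta> > 0\<close> A1 in auto)
    finally show ?thesis by (simp add: A_def algebra_simps)
  qed
  ultimately have "(\<integral>t. norm (ft w t) \<partial>lborel) \<le> 4 * pi * (s + 1) * (A * \<delta>)"
    by (rule integral_norm_ft_le[OF dw vw \<open>s > 0\<close>])
  also have "\<dots> \<le> C * \<delta>" using \<open>\<delta> > 0\<close> \<open>s > 0\<close> by (simp add: C_def algebra_simps)
  also have "\<dots> < \<epsilon>" using \<open>\<epsilon> > 0\<close> \<open>C > 0\<close> by (simp add: \<delta>_def)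
  finally have small: "(\<integral>t. norm (ft w t) \<partial>lborel) < \<epsilon>" .
  have int: "integrable lborel \<Phi>" "integrable lborel (\<lambda>x. \<Phi> x * H x)"
      "integrable lborel (\<lambda>x. \<Phi> x * exp_sum F c 0 x)"
    using v by (auto intro!: integrable_vanishes_beyond[of _ s] continuous_intros
      has_C2_derivs_continuous[OF d\<Phi>] has_C2_derivs_continuous[OF dH]
      has_C2_derivs_continuous[OF has_C2_derivs_exp_sum] simp: vanishes_beyond_def)
  have "ft w t = ft (\<lambda>x. \<Phi> x * H x) t - (\<Sum>l\<in>F. c l * ft \<Phi> (t - l))" for t
    unfolding w_def right_diff_distrib by (simp add: ft_diff int ft_exp_sum)
  with small F show thesis by (intro that[of F c]) simp_all
qed

section \<open>The generator as an \<open>L\<^sup>1\<close> limit\<close>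

text \<open>The telescoping series converges absolutely almost everywhere since the sum of its norms
  has finite integral. The tail bound is stated for every n because the later argument compares the
  limit with each stage.\<close>

lemma L1_limit:
  fixes f :: "nat \<Rightarrow> 'b \<Rightarrow> 'a::{banach, second_countable_topology}"
  assumes f: "\<And>n. integrable M (f n)"
    and d: "\<And>n. (\<integral>x. norm (f (Suc n) x - f n x) \<partial>M) \<le> d n" and "summable d"
  obtains g where "integrable M g" "\<And>n. (\<integral>x. norm (g x - f n x) \<partial>M) \<le> (\<Sum>k. d (k + n))"
proof -
  define a where "a k x = f (Suc k) x - f k x" for k x
  have a: "integrable M (a k)" for k unfolding a_def using f by auto
  then have [measurable]: "a k \<in> borel_measurable M" for k by (rule borel_measurable_integrable)
  have sd: "summable (\<lambda>k. \<integral>x. norm (a k x) \<partial>M)"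
    by (rule summable_comparison_test'[OF \<open>summable d\<close>, of 0]) (use d in \<open>simp add: a_def\<close>)
  have "(\<integral>\<^sup>+x. (\<Sum>k. ennreal (norm (a k x))) \<partial>M) = (\<Sum>k. \<integral>\<^sup>+x. ennreal (norm (a k x)) \<partial>M)"
    by (rule nn_integral_suminf) measurable
  also have "\<dots> = (\<Sum>k. ennreal (\<integral>x. norm (a k x) \<partial>M))"
    using a by (intro suminf_cong nn_integral_eq_integral) auto
  also have "\<dots> = ennreal (\<Sum>k. \<integral>x. norm (a k x) \<partial>M)"
    by (rule suminf_ennreal2[OF _ sd]) simp
  finally have "(\<integral>\<^sup>+x. (\<Sum>k. ennreal (norm (a k x))) \<partial>M) \<noteq> \<infinity>" by simp
  then have "AE x in M. (\<Sum>k. ennreal (norm (a k x))) \<noteq> \<infinity>"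
    by (intro nn_integral_noteq_infinite) measurable
  then have AEs: "AE x in M. summable (\<lambda>k. norm (a k x))"
    by eventually_elim (auto intro: summable_suminf_not_top)
  define g where "g x = f 0 x + (\<Sum>k. a k x)" for x
  have int: "integrable M (\<lambda>x. \<Sum>k. a k x)"
    by (rule integrable_suminf[OF a AEs sd])
  have g: "integrable M g" unfolding g_def using f int by auto
  show thesis
  proof (rule that[OF g])
    fix n
    have AEn: "AE x in M. summable (\<lambda>k. norm (norm (a (k + n) x)))"
      using AEs
    proof eventually_elim
      case (elim x)
      then show ?case using summable_ignore_initial_segment[OF elim, of n] by simp
    qed
    have sdn: "summable (\<lambda>k. \<integral>x. norm (norm (a (k + n) x)) \<partial>M)"
      using summable_ignore_initial_segment[OF sd, of n] by simp
    have intn: "integrable M (\<lambda>x. norm (a (k + n) x))" for k using a by auto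
    have "(\<integral>x. norm (g x - f n x) \<partial>M) \<le> (\<integral>x. (\<Sum>k. norm (a (k + n) x)) \<partial>M)"
    proof (rule integral_mono_AE)
      show "integrable M (\<lambda>x. \<Sum>k. norm (a (k + n) x))"
        by (rule integrable_suminf[OF intn AEn sdn])
      show "AE x in M. norm (g x - f n x) \<le> (\<Sum>k. norm (a (k + n) x))"
        using AEs
      proof eventually_elim
        case (elim x)
        then have s: "summable (\<lambda>k. a k x)" by (rule summable_norm_cancel)
        have "(\<Sum>k<n. a k x) = f n x - f 0 x"
          unfolding a_def by (rule sum_lessThan_telescope)
        then have "g x - f n x = (\<Sum>k. a (k + n) x)"
          using suminf_split_initial_segment[OF s, of n] by (simp add: g_def)
        also have "norm \<dots> \<le> (\<Sum>k. norm (a (k + n) x))"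
          by (rule summable_norm[OF summable_ignore_initial_segment[OF elim]])
        finally show ?case .
      qed
    qed (use f g in auto)
    also have "\<dots> = (\<Sum>k. \<integral>x. norm (a (k + n) x) \<partial>M)"
      by (rule integral_suminf[OF intn AEn sdn])
    also have "\<dots> \<le> (\<Sum>k. d (k + n))"
      by (intro suminf_le summable_ignore_initial_segment[OF sd]
          summable_ignore_initial_segment[OF \<open>summable d\<close>]) (simp add: a_def d)
    finally show "(\<integral>x. norm (g x - f n x) \<partial>M) \<le> (\<Sum>k. d (k + n))" .
  qed
qed

text \<open>Nonnegativity of the profile excludes cancellation when a positive multiple of a bump is
  added to it.\<close>

definition band_limited :: "(real \<Rightarrow> complex) \<Rightarrow> bool" where
  "band_limited \<phi> \<longleftrightarrow> (\<exists>\<Phi> r. C2 \<Phi> \<and> (\<forall>x. \<Phi> x \<ge> 0) \<and> vanishes_beyond r \<Phi> \<and>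
     \<phi> = ft (\<lambda>x. complex_of_real (\<Phi> x)))"

lemma vanishes_beyond_of_real:
  "vanishes_beyond r \<Phi> \<Longrightarrow> vanishes_beyond r (\<lambda>x. complex_of_real (\<Phi> x))"
  by (simp add: vanishes_beyond_def)

lemma band_limited_integrable: "band_limited \<phi> \<Longrightarrow> integrable lborel \<phi>"
  unfolding band_limited_def using integrable_ft C2_of_real vanishes_beyond_of_real by blast

lemma vanishes_beyond_bump: "r \<ge> 0 \<Longrightarrow> vanishes_beyond r (bump r)"
  by (simp add: vanishes_beyond_def bump_outside)

text \<open>The density half of the category argument. Once the perturbed profile \<Psi> is positive
  on the support of h, one may write h as \<Psi> times a C2 function and approximate that factor by
  exponential sums.\<close>

lemma band_limited_perturb:
  assumes complete: "\<forall>\<rho>>0. exp_complete \<Lambda> \<rho>"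
    and \<phi>: "band_limited \<phi>" and h: "C2 h" "vanishes_beyond r h" and "\<delta> > 0" "\<epsilon> > 0"
  obtains \<psi> F c where "band_limited \<psi>" "(\<integral>t. norm (\<psi> t - \<phi> t) \<partial>lborel) < \<delta>"
    "finite F" "F \<subseteq> \<Lambda>" "(\<integral>t. norm (ft h t - (\<Sum>l\<in>F. c l * \<psi> (t - l))) \<partial>lborel) < \<epsilon>"
proof -
  obtain \<Phi> R where \<Phi>: "C2 \<Phi>" "\<And>x. \<Phi> x \<ge> 0" "vanishes_beyond R \<Phi>"
    and \<phi>_eq: "\<phi> = ft (\<lambda>x. complex_of_real (\<Phi> x))"
    using \<phi> unfolding band_limited_def by auto
  \<comment> \<open>The sign of r is unknown; radius s + 1 makes the bump positive on all of
    [-s, s], endpoints included.\<close>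
  define s where "s = \<bar>r\<bar>"
  define b where "b = bump (s + 1)"
  have b: "C2 b" "\<And>x. b x \<ge> 0" "vanishes_beyond (s + 1) b" "\<And>x. \<bar>x\<bar> < s + 1 \<Longrightarrow> b x > 0"
    by (auto simp: b_def s_def C2_bump bump_nonneg vanishes_beyond_bump bump_pos)
  define B where "B = (\<integral>t. norm (ft (\<lambda>x. complex_of_real (b x)) t) \<partial>lborel)"
  have "B \<ge> 0" by (simp add: B_def)
  \<comment> \<open>The perturbation has L1 norm \<open>d * B\<close>; the added 1 gives strict
    inequality and a nonzero denominator.\<close>
  define d where "d = \<delta> / (B + 1)"
  have "d > 0" and dB: "d * B < \<delta>" using \<open>B \<ge> 0\<close> \<open>\<delta> > 0\<close> by (simp_all add: d_def field_simps)
  define \<Psi> where "\<Psi> x = \<Phi> x + d * b x" for x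
  define S where "S = max R (s + 1)"
  have \<Psi>: "C2 \<Psi>" "\<And>x. \<Psi> x \<ge> 0" "vanishes_beyond S \<Psi>"
    using \<Phi> b \<open>d > 0\<close> by (auto simp: \<Psi>_def[abs_def] S_def vanishes_beyond_def
      intro!: C2_add C2_mult C2_const)
  define \<psi> where "\<psi> = ft (\<lambda>x. complex_of_real (\<Psi> x))"
  have "band_limited \<psi>" unfolding band_limited_def \<psi>_def using \<Psi> by blast
  have "\<psi> t - \<phi> t = of_real d * ft (\<lambda>x. complex_of_real (b x)) t" for t
  proof -
    have "integrable lborel (\<lambda>x. complex_of_real (\<Phi> x))" "integrable lborel (\<lambda>x. complex_of_real (b x))"
      using \<Phi> b by (auto intro!: integrable_vanishes_beyond[of _ S] C2_continuous C2_of_real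
        simp: vanishes_beyond_def S_def)
    then show ?thesis
      by (simp add: \<psi>_def \<phi>_eq \<Psi>_def ft_add ft_cmult)
  qed
  then have "(\<integral>t. norm (\<psi> t - \<phi> t) \<partial>lborel) = d * B"
    using \<open>d > 0\<close> by (simp add: norm_mult B_def)
  then have close: "(\<integral>t. norm (\<psi> t - \<phi> t) \<partial>lborel) < \<delta>" using dB by simp
  txt \<open>Adding to \<open>\<Psi>\<close> a function that vanishes on the support of \<open>h\<close> makes it globally invertible
    without affecting the quotient \<open>h / \<Psi>\<close>.\<close>
  define \<Theta> where "\<Theta> x = \<Psi> x + max 0 (x\<^sup>2 - s\<^sup>2) ^ 3" for x
  have "\<Theta> x > 0" for x
  proof (cases "\<bar>x\<bar> < s + 1")
    case True
    then have "\<Psi> x > 0" unfolding \<Psi>_def using \<Phi>(2) b(4) \<open>d > 0\<close> by (simp add: add_nonneg_pos)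
    then show ?thesis unfolding \<Theta>_def by (simp add: add_pos_nonneg)
  next
    case False
    then have "s\<^sup>2 < \<bar>x\<bar>\<^sup>2" by (intro power_strict_mono) (auto simp: s_def)
    then show ?thesis unfolding \<Theta>_def using \<Psi>(2) by (simp add: add_nonneg_pos)
  qed
  then have \<Theta>_nz: "\<Theta> x \<noteq> 0" for x by (simp add: less_imp_neq[symmetric])
  have "C2 \<Theta>" unfolding \<Theta>_def[abs_def] by (intro C2_add \<Psi> C2_outer_bump)
  then have "C2 (\<lambda>x. h x * of_real (inverse (\<Theta> x)))"
    by (intro C2_mult h C2_of_real C2_inverse \<Theta>_nz)
  from ft_mult_approx[OF complete C2_of_real[OF \<Psi>(1)] vanishes_beyond_of_real[OF \<Psi>(3)] this \<open>\<epsilon> > 0\<close>]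
  obtain F c where F: "finite F" "F \<subseteq> \<Lambda>" "(\<integral>t. norm (ft (\<lambda>x. of_real (\<Psi> x) * (h x * of_real (inverse (\<Theta> x)))) t
      - (\<Sum>l\<in>F. c l * ft (\<lambda>x. of_real (\<Psi> x)) (t - l))) \<partial>lborel) < \<epsilon>" by blast
  have "(\<lambda>x. of_real (\<Psi> x) * (h x * of_real (inverse (\<Theta> x)))) = h"
  proof (rule ext)
    fix x
    show "of_real (\<Psi> x) * (h x * of_real (inverse (\<Theta> x))) = h x"
    proof (cases "\<bar>x\<bar> < r")
      case True
      then have "\<bar>x\<bar>\<^sup>2 \<le> s\<^sup>2" by (intro power_mono) (auto simp: s_def)
      then have "\<Theta> x = \<Psi> x" by (simp add: \<Theta>_def)
      with \<Theta>_nz[of x] show ?thesis by simp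
    next
      case False
      then show ?thesis using h(2) by (simp add: vanishes_beyond_def)
    qed
  qed
  with F(3) have "(\<integral>t. norm (ft h t - (\<Sum>l\<in>F. c l * \<psi> (t - l))) \<partial>lborel) < \<epsilon>"
    by (simp only: \<psi>_def)
  with \<open>band_limited \<psi>\<close> close F(1,2) show thesis by (rule that)
qed

section \<open>Stability of combinations of translates and the category argument\<close>

lemma integrable_translate:
  fixes \<phi> :: "real \<Rightarrow> complex"
  assumes "integrable lborel \<phi>"
  shows "integrable lborel (\<lambda>t. \<phi> (t - l))"
    and "(\<integral>t. norm (\<phi> (t - l)) \<partial>lborel) = (\<integral>t. norm (\<phi> t) \<partial>lborel)"
  using lborel_integrable_real_affine[OF assms, of 1 "-l"]
    lborel_integral_real_affine[of 1 "\<lambda>t. norm (\<phi> t)" "-l"] by (simp_all add: add.commute)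

lemma integrable_translates:
  fixes \<phi> :: "real \<Rightarrow> complex"
  shows "integrable lborel \<phi> \<Longrightarrow> integrable lborel (\<lambda>t. \<Sum>l\<in>F. c l * \<phi> (t - l))"
  by (intro Bochner_Integration.integrable_sum integrable_mult_right integrable_translate)

text \<open>The sum of the norms of the coefficients is a Lipschitz constant for the dependence on
  the generator; the construction below tunes its step sizes to it.\<close>

lemma integral_norm_translates_le:
  fixes \<phi> :: "real \<Rightarrow> complex"
  assumes "integrable lborel \<phi>"
  shows "(\<integral>t. norm (\<Sum>l\<in>F. c l * \<phi> (t - l)) \<partial>lborel) \<le> (\<Sum>l\<in>F. norm (c l)) * (\<integral>t. norm (\<phi> t) \<partial>lborel)"
proof -
  have "(\<integral>t. norm (\<Sum>l\<in>F. c l * \<phi> (t - l)) \<partial>lborel) \<le> (\<integral>t. (\<Sum>l\<in>F. norm (c l) * norm (\<phi> (t - l))) \<partial>lborel)"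
    by (intro integral_mono integrable_norm integrable_translates Bochner_Integration.integrable_sum
        integrable_mult_right integrable_translate assms norm_sum[THEN order_trans]) (simp add: norm_mult)
  also have "\<dots> = (\<Sum>l\<in>F. norm (c l) * (\<integral>t. norm (\<phi> (t - l)) \<partial>lborel))"
    by (subst Bochner_Integration.integral_sum)
       (auto intro!: integrable_mult_right integrable_norm integrable_translate assms)
  also have "\<dots> = (\<Sum>l\<in>F. norm (c l)) * (\<integral>t. norm (\<phi> t) \<partial>lborel)"
    by (simp add: integrable_translate(2)[OF assms] sum_distrib_right)
  finally show ?thesis .
qed

lemma integral_norm_triangle:
  fixes f g h :: "'b \<Rightarrow> complex"
  assumes "integrable M f" "integrable M g" "integrable M h"
  shows "(\<integral>t. norm (f t - h t) \<partial>M) \<le> (\<integral>t. norm (f t - g t) \<partial>M) + (\<integral>t. norm (g t - h t) \<partial>M)"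
proof -
  have "norm (f t - h t) \<le> norm (f t - g t) + norm (g t - h t)" for t
    using norm_triangle_ineq[of "f t - g t" "g t - h t"] by simp
  then have "(\<integral>t. norm (f t - h t) \<partial>M) \<le> (\<integral>t. norm (f t - g t) + norm (g t - h t) \<partial>M)"
    using assms by (intro integral_mono) auto
  also have "\<dots> = (\<integral>t. norm (f t - g t) \<partial>M) + (\<integral>t. norm (g t - h t) \<partial>M)"
    using assms by (intro Bochner_Integration.integral_add) auto
  finally show ?thesis .
qed

text \<open>A concrete Baire category argument: each stage perturbs the previous \<open>\<phi>\<close> so little
  that the approximations of the earlier targets survive in the limit.\<close>

lemma simultaneous_approx:
  fixes h :: "nat \<Rightarrow> real \<Rightarrow> complex"
  assumes complete: "\<forall>\<rho>>0. exp_complete \<Lambda> \<rho>"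
    and h: "\<And>n. C2 (h n)" "\<And>n. \<exists>r. vanishes_beyond r (h n)"
  obtains \<phi> where "integrable lborel \<phi>"
    "\<And>n. \<exists>F c. finite F \<and> F \<subseteq> \<Lambda> \<and>
      (\<integral>t. norm (ft (h n) t - (\<Sum>l\<in>F. c l * \<phi> (t - l))) \<partial>lborel) < 2 / real (Suc n)"
proof -
  \<comment> \<open>The state carries, besides the generator, a bound N for the coefficients used so
    far: it measures how fragile the achieved approximations are.\<close>
  define P where "P n = (\<lambda>(\<psi>, N). band_limited \<psi> \<and> N \<ge> (1::real) \<and>
    (\<exists>F c. finite F \<and> F \<subseteq> \<Lambda> \<and> (\<Sum>l\<in>F. norm (c l)) \<le> N \<and>
      (\<integral>t. norm (ft (h n) t - (\<Sum>l\<in>F. c l * \<psi> (t - l))) \<partial>lborel) < 1 / real (Suc n)))" for n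
  \<comment> \<open>By monotonicity of N, all moves after stage n add up to at most
    \<open>1 / (Suc n * N n)\<close>. Combined with coefficients of total size \<open>N n\<close>
    they cost \<open>1 / Suc n\<close>, on top of the same amount allowed at the stage
    itself.\<close>
  define Q where "Q n = (\<lambda>(\<psi> :: real \<Rightarrow> complex, N) (\<psi>', N'). N \<le> N' \<and>
    (\<integral>t. norm (\<psi>' t - \<psi> t) \<partial>lborel) \<le> (1/2) ^ Suc n / (real (Suc n) * (N::real)))" for n :: nat
  have step: "\<exists>\<psi>' N'. P n (\<psi>', N') \<and> N \<le> N' \<and> (\<integral>t. norm (\<psi>' t - \<psi> t) \<partial>lborel) \<le> \<delta>"
    if \<psi>: "band_limited \<psi>" and "\<delta> > 0" for n \<psi> N \<delta>
  proof -
    obtain r where r: "vanishes_beyond r (h n)" using h(2) by blast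
    have pos: "1 / real (Suc n) > 0" by simp
    obtain \<psi>' F c where *: "band_limited \<psi>'" "(\<integral>t. norm (\<psi>' t - \<psi> t) \<partial>lborel) < \<delta>"
      "finite F" "F \<subseteq> \<Lambda>" "(\<integral>t. norm (ft (h n) t - (\<Sum>l\<in>F. c l * \<psi>' (t - l))) \<partial>lborel) < 1 / real (Suc n)"
      by (rule band_limited_perturb[OF complete \<psi> h(1) r \<open>\<delta> > 0\<close> pos]; rule that; assumption)
    let ?N = "max (max 1 N) (\<Sum>l\<in>F. norm (c l))"
    have "P n (\<psi>', ?N)"
      unfolding P_def prod.case using * by (intro conjI exI[of _ F] exI[of _ c]) auto
    moreover have "N \<le> ?N" by simp
    ultimately show ?thesis using *(2) less_imp_le by blast
  qed
  \<comment> \<open>The zero function is a legitimate seed: the first perturbation already makes the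
    profile positive where it is needed.\<close>
  have "band_limited (ft (\<lambda>x. complex_of_real 0))"
    unfolding band_limited_def
    by (intro exI[of _ "\<lambda>x. 0"] exI[of _ 0]) (auto simp: C2_const vanishes_beyond_def)
  from step[OF this, of 1 0 1] have init: "\<exists>z. P 0 z" by auto
  have "\<exists>y. P (Suc n) y \<and> Q n z y" if "P n z" for n z
  proof -
    obtain \<psi> N where z: "z = (\<psi>, N)" by force
    then have "band_limited \<psi>" "(1/2) ^ Suc n / (real (Suc n) * N) > 0"
      using that by (auto simp: P_def)
    from step[OF this, of "Suc n" N] show ?thesis by (auto simp: Q_def z)
  qed
  from dependent_nat_choice[of P Q, OF init this]
  obtain z where zP: "\<And>n. P n (z n)" and zQ: "\<And>n. Q n (z n) (z (Suc n))" by metis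
  define \<psi> N where "\<psi> n = fst (z n)" and "N n = snd (z n)" for n
  have \<psi>: "band_limited (\<psi> n)" and N1: "N n \<ge> 1" for n
    using zP[of n] by (auto simp: P_def \<psi>_def N_def split: prod.splits)
  have N_mono: "N n \<le> N (Suc n)"
    and d: "(\<integral>t. norm (\<psi> (Suc n) t - \<psi> n t) \<partial>lborel) \<le> (1/2) ^ Suc n / (real (Suc n) * N n)" for n
    using zQ[of n] by (auto simp: Q_def \<psi>_def N_def split: prod.splits)
  have N_le: "N n \<le> N (k + n)" for n k
    using lift_Suc_mono_le[of N n "k + n"] N_mono by simp
  have half: "(\<lambda>k. (1/2) ^ Suc k) sums (1::real)"
    using power_half_series .
  let ?d = "\<lambda>n. (1/2) ^ Suc n / (real (Suc n) * N n)"
  have d_le: "?d (k + n) \<le> (1/2) ^ Suc k * (1 / (real (Suc n) * N n))" for k n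
  proof -
    have "?d (k + n) \<le> (1/2) ^ Suc k / (real (Suc n) * N n)"
      using N_le[of n k] N1[of n]
      by (intro frac_le mult_mono power_decreasing mult_pos_pos) auto
    then show ?thesis by simp
  qed
  have sd: "summable ?d"
    by (rule summable_comparison_test'[of "\<lambda>k. (1/2) ^ Suc k * (1 / (real (Suc 0) * N 0))" 0])
       (use d_le[of _ 0] N1 in \<open>auto intro!: summable_mult2 sums_summable[OF half]
         simp del: power_Suc simp: order_trans[OF zero_le_one]\<close>)
  obtain \<phi> where \<phi>: "integrable lborel \<phi>"
    and close: "\<And>n. (\<integral>t. norm (\<phi> t - \<psi> n t) \<partial>lborel) \<le> (\<Sum>k. ?d (k + n))"
    using L1_limit[of lborel \<psi> ?d, OF band_limited_integrable[OF \<psi>] d sd] by blast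
  show thesis
  proof (rule that[OF \<phi>])
    fix n
    have close_n: "(\<integral>t. norm (\<psi> n t - \<phi> t) \<partial>lborel) \<le> 1 / (real (Suc n) * N n)"
    proof -
      have "(\<Sum>k. ?d (k + n)) \<le> (\<Sum>k. (1/2) ^ Suc k * (1 / (real (Suc n) * N n)))"
        by (intro suminf_le d_le summable_mult2 sums_summable[OF half]
            summable_ignore_initial_segment[OF sd])
      also have "\<dots> = 1 / (real (Suc n) * N n)"
        using sums_mult2[OF half, of "1 / (real (Suc n) * N n)"] by (simp add: sums_iff)
      finally show ?thesis using close[of n] by (simp add: norm_minus_commute)
    qed
    obtain F c where F: "finite F" "F \<subseteq> \<Lambda>" "(\<Sum>l\<in>F. norm (c l)) \<le> N n"
      "(\<integral>t. norm (ft (h n) t - (\<Sum>l\<in>F. c l * \<psi> n (t - l))) \<partial>lborel) < 1 / real (Suc n)"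
      using zP[of n] by (auto simp: P_def \<psi>_def N_def split: prod.splits)
    obtain r where "vanishes_beyond r (h n)" using h(2) by blast
    then have ih: "integrable lborel (ft (h n))" by (rule integrable_ft[OF h(1)])
    note i\<psi> = band_limited_integrable[OF \<psi>]
    have "(\<integral>t. norm ((\<Sum>l\<in>F. c l * \<psi> n (t - l)) - (\<Sum>l\<in>F. c l * \<phi> (t - l))) \<partial>lborel)
        = (\<integral>t. norm (\<Sum>l\<in>F. c l * (\<psi> n (t - l) - \<phi> (t - l))) \<partial>lborel)"
      by (simp add: sum_subtractf right_diff_distrib)
    also have "\<dots> \<le> (\<Sum>l\<in>F. norm (c l)) * (\<integral>t. norm (\<psi> n t - \<phi> t) \<partial>lborel)"
      using integral_norm_translates_le[of "\<lambda>t. \<psi> n t - \<phi> t" c F] i\<psi> \<phi> by simp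
    also have "\<dots> \<le> N n * (1 / (real (Suc n) * N n))"
      by (intro mult_mono F(3) close_n) (use N1[of n] in auto)
    also have "\<dots> = 1 / real (Suc n)" using N1[of n] by simp
    finally have "(\<integral>t. norm (ft (h n) t - (\<Sum>l\<in>F. c l * \<phi> (t - l))) \<partial>lborel) < 2 / real (Suc n)"
      using integral_norm_triangle[OF ih integrable_translates[OF i\<psi>[of n], where F=F and c=c]
          integrable_translates[OF \<phi>, where F=F and c=c]] F(4) by simp
    with F(1,2) show "\<exists>F c. finite F \<and> F \<subseteq> \<Lambda> \<and>
      (\<integral>t. norm (ft (h n) t - (\<Sum>l\<in>F. c l * \<phi> (t - l))) \<partial>lborel) < 2 / real (Suc n)" by blast
  qed
qed

text \<open>Density tested one function at a time. As a closed linear subspace this can be spread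
  from generators to all integrable functions.\<close>

definition in_L1_span :: "real set \<Rightarrow> (real \<Rightarrow> complex) \<Rightarrow> (real \<Rightarrow> complex) \<Rightarrow> bool" where
  "in_L1_span \<Lambda> \<phi> f \<longleftrightarrow> integrable lborel f \<and>
     (\<forall>\<epsilon>>0. \<exists>F c. finite F \<and> F \<subseteq> \<Lambda> \<and>
           (\<integral>t. norm (f t - (\<Sum>l\<in>F. c l * \<phi> (t - l))) \<partial>lborel) < \<epsilon>)"

text \<open>\<open>simultaneous_approx\<close> gives one fixed precision per index. Enumerating
  through \<open>prod_decode\<close> repeats each target infinitely often, and at the index of (n,
  m), which is at least m, the precision is as good as desired.\<close>

lemma dense_sequence_in_L1_span:
  fixes h :: "nat \<Rightarrow> real \<Rightarrow> complex"
  assumes complete: "\<forall>\<rho>>0. exp_complete \<Lambda> \<rho>"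
    and h: "\<And>n. C2 (h n)" "\<And>n. \<exists>r. vanishes_beyond r (h n)"
  obtains \<phi> where "integrable lborel \<phi>" "\<And>n. in_L1_span \<Lambda> \<phi> (ft (h n))"
proof -
  obtain \<phi> where \<phi>: "integrable lborel \<phi>"
    and approx: "\<And>j. \<exists>F c. finite F \<and> F \<subseteq> \<Lambda> \<and>
      (\<integral>t. norm (ft (h (fst (prod_decode j))) t - (\<Sum>l\<in>F. c l * \<phi> (t - l))) \<partial>lborel) < 2 / real (Suc j)"
    by (rule simultaneous_approx[OF complete, of "\<lambda>j. h (fst (prod_decode j))", OF h]; rule that; assumption)
  show thesis
  proof (rule that[OF \<phi>])
    fix n
    have "\<exists>F c. finite F \<and> F \<subseteq> \<Lambda> \<and> (\<integral>t. norm (ft (h n) t - (\<Sum>l\<in>F. c l * \<phi> (t - l))) \<partial>lborel) < \<epsilon>"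
      if "\<epsilon> > 0" for \<epsilon>
    proof -
      obtain m where m: "2 / \<epsilon> < real m" using reals_Archimedean2 by blast
      define j where "j = prod_encode (n, m)"
      have "m \<le> j" by (simp add: j_def le_prod_encode_2)
      then have "2 / \<epsilon> < real (Suc j)" using m by linarith
      then have "2 / real (Suc j) < \<epsilon>" using \<open>\<epsilon> > 0\<close> by (simp add: field_simps)
      moreover have "fst (prod_decode j) = n" by (simp add: j_def)
      moreover obtain F c where "finite F" "F \<subseteq> \<Lambda>"
        "(\<integral>t. norm (ft (h (fst (prod_decode j))) t - (\<Sum>l\<in>F. c l * \<phi> (t - l))) \<partial>lborel) < 2 / real (Suc j)"
        using approx[of j] by blast
      ultimately show ?thesis by (intro exI[of _ F] exI[of _ c]) simp
    qed
    moreover have "integrable lborel (ft (h n))" using h integrable_ft by blast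
    ultimately show "in_L1_span \<Lambda> \<phi> (ft (h n))" by (simp add: in_L1_span_def)
  qed
qed

lemma in_L1_span_lim:
  assumes \<phi>: "integrable lborel \<phi>" and f: "integrable lborel f"
    and "\<And>\<epsilon>. \<epsilon> > 0 \<Longrightarrow> \<exists>g. in_L1_span \<Lambda> \<phi> g \<and> (\<integral>t. norm (f t - g t) \<partial>lborel) < \<epsilon>"
  shows "in_L1_span \<Lambda> \<phi> f"
  unfolding in_L1_span_def
proof (intro conjI allI impI f)
  fix \<epsilon> :: real assume "\<epsilon> > 0"
  then obtain g where g: "in_L1_span \<Lambda> \<phi> g" "(\<integral>t. norm (f t - g t) \<partial>lborel) < \<epsilon> / 2"
    using assms(3) half_gt_zero by blast
  then obtain F c where F: "finite F" "F \<subseteq> \<Lambda>" "(\<integral>t. norm (g t - (\<Sum>l\<in>F. c l * \<phi> (t - l))) \<partial>lborel) < \<epsilon> / 2"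
    using \<open>\<epsilon> > 0\<close> half_gt_zero unfolding in_L1_span_def by meson
  have ig: "integrable lborel g" using g(1) by (simp add: in_L1_span_def)
  have "(\<integral>t. norm (f t - (\<Sum>l\<in>F. c l * \<phi> (t - l))) \<partial>lborel) < \<epsilon>"
    using integral_norm_triangle[OF f ig integrable_translates[OF \<phi>, where F=F and c=c]] g(2) F(3) by simp
  with F(1,2) show "\<exists>F c. finite F \<and> F \<subseteq> \<Lambda> \<and>
      (\<integral>t. norm (f t - (\<Sum>l\<in>F. c l * \<phi> (t - l))) \<partial>lborel) < \<epsilon>" by blast
qed

lemma in_L1_span_cmult:
  assumes "in_L1_span \<Lambda> \<phi> f"
  shows "in_L1_span \<Lambda> \<phi> (\<lambda>t. a * f t)"
  unfolding in_L1_span_def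
proof (intro conjI allI impI)
  show "integrable lborel (\<lambda>t. a * f t)" using assms by (simp add: in_L1_span_def)
  fix \<epsilon> :: real assume "\<epsilon> > 0"
  then have "\<epsilon> / (norm a + 1) > 0" by (simp add: add_nonneg_pos)
  then obtain F c where F: "finite F" "F \<subseteq> \<Lambda>"
    "(\<integral>t. norm (f t - (\<Sum>l\<in>F. c l * \<phi> (t - l))) \<partial>lborel) < \<epsilon> / (norm a + 1)"
    using assms unfolding in_L1_span_def by meson
  have "(\<integral>t. norm (a * f t - (\<Sum>l\<in>F. (a * c l) * \<phi> (t - l))) \<partial>lborel)
      = (\<integral>t. norm a * norm (f t - (\<Sum>l\<in>F. c l * \<phi> (t - l))) \<partial>lborel)"
    by (simp add: norm_mult[symmetric] right_diff_distrib sum_distrib_left mult.assoc)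
  also have "\<dots> \<le> (norm a + 1) * (\<integral>t. norm (f t - (\<Sum>l\<in>F. c l * \<phi> (t - l))) \<partial>lborel)"
    by (simp add: mult_right_mono)
  also have "\<dots> < \<epsilon>" using F(3) by (simp add: pos_less_divide_eq add_nonneg_pos mult.commute)
  finally show "\<exists>F c. finite F \<and> F \<subseteq> \<Lambda> \<and>
      (\<integral>t. norm (a * f t - (\<Sum>l\<in>F. c l * \<phi> (t - l))) \<partial>lborel) < \<epsilon>"
    using F(1,2) by (intro exI[of _ F] exI[of _ "\<lambda>l. a * c l"]) simp
qed

lemma sum_extend_zero:
  fixes c :: "real \<Rightarrow> complex"
  assumes "finite G" "F \<subseteq> G"
  shows "(\<Sum>l\<in>F. c l * e l) = (\<Sum>l\<in>G. (if l \<in> F then c l else 0) * e l)"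
  by (rule sum.mono_neutral_cong_left[OF assms]) auto

lemma in_L1_span_add:
  assumes \<phi>: "integrable lborel \<phi>" and "in_L1_span \<Lambda> \<phi> f" "in_L1_span \<Lambda> \<phi> g"
  shows "in_L1_span \<Lambda> \<phi> (\<lambda>t. f t + g t)"
  unfolding in_L1_span_def
proof (intro conjI allI impI)
  have int: "integrable lborel f" "integrable lborel g" using assms by (simp_all add: in_L1_span_def)
  then show "integrable lborel (\<lambda>t. f t + g t)" by simp
  fix \<epsilon> :: real assume "\<epsilon> > 0"
  then obtain F c where F: "finite F" "F \<subseteq> \<Lambda>"
    "(\<integral>t. norm (f t - (\<Sum>l\<in>F. c l * \<phi> (t - l))) \<partial>lborel) < \<epsilon> / 2"
    using assms(2) half_gt_zero unfolding in_L1_span_def by meson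
  from \<open>\<epsilon> > 0\<close> obtain G d where G: "finite G" "G \<subseteq> \<Lambda>"
    "(\<integral>t. norm (g t - (\<Sum>l\<in>G. d l * \<phi> (t - l))) \<partial>lborel) < \<epsilon> / 2"
    using assms(3) half_gt_zero unfolding in_L1_span_def by meson
  let ?b = "\<lambda>l. (if l \<in> F then c l else 0) + (if l \<in> G then d l else 0)"
  have b: "(\<Sum>l\<in>F \<union> G. ?b l * \<phi> (t - l)) = (\<Sum>l\<in>F. c l * \<phi> (t - l)) + (\<Sum>l\<in>G. d l * \<phi> (t - l))" for t
    using sum_extend_zero[of "F \<union> G" F c "\<lambda>l. \<phi> (t - l)"] sum_extend_zero[of "F \<union> G" G d "\<lambda>l. \<phi> (t - l)"]
      F(1) G(1) by (simp only: distrib_right sum.distrib finite_Un Un_upper1 Un_upper2)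
  have i: "integrable lborel (\<lambda>t. f t - (\<Sum>l\<in>F. c l * \<phi> (t - l)))"
    "integrable lborel (\<lambda>t. g t - (\<Sum>l\<in>G. d l * \<phi> (t - l)))"
    by (intro Bochner_Integration.integrable_diff int integrable_translates \<phi>)+
  have "(\<integral>t. norm (f t + g t - (\<Sum>l\<in>F \<union> G. ?b l * \<phi> (t - l))) \<partial>lborel)
      \<le> (\<integral>t. norm (f t - (\<Sum>l\<in>F. c l * \<phi> (t - l))) + norm (g t - (\<Sum>l\<in>G. d l * \<phi> (t - l))) \<partial>lborel)"
    unfolding b
    by (intro integral_mono Bochner_Integration.integrable_add integrable_norm i
        Bochner_Integration.integrable_diff int integrable_translates \<phi> norm_diff_triangle_ineq)
  also have "\<dots> = (\<integral>t. norm (f t - (\<Sum>l\<in>F. c l * \<phi> (t - l))) \<partial>lborel)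
      + (\<integral>t. norm (g t - (\<Sum>l\<in>G. d l * \<phi> (t - l))) \<partial>lborel)"
    by (intro Bochner_Integration.integral_add integrable_norm i)
  also have "\<dots> < \<epsilon>" using F(3) G(3) by simp
  finally show "\<exists>F c. finite F \<and> F \<subseteq> \<Lambda> \<and>
      (\<integral>t. norm (f t + g t - (\<Sum>l\<in>F. c l * \<phi> (t - l))) \<partial>lborel) < \<epsilon>"
    using F(1,2) G(1,2) by (intro exI[of _ "F \<union> G"] exI[of _ ?b]) auto
qed

section \<open>An approximate identity\<close>

text \<open>The kernels to which this is applied are unimodular exponentials, so
  \<open>norm (f x) * norm (g y)\<close> dominates on the product space.\<close>

lemma Fubini_bounded_kernel:
  fixes f g :: "real \<Rightarrow> complex" and k :: "real \<Rightarrow> real \<Rightarrow> complex"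
  assumes f: "integrable lborel f" and g: "integrable lborel g"
    and [measurable]: "(\<lambda>(x, y). k x y) \<in> borel_measurable (borel \<Otimes>\<^sub>M borel)"
    and k: "\<And>x y. norm (k x y) \<le> 1"
  shows "(\<integral>x. f x * (\<integral>y. g y * k x y \<partial>lborel) \<partial>lborel)
       = (\<integral>y. g y * (\<integral>x. f x * k x y \<partial>lborel) \<partial>lborel)"
proof -
  have [measurable]: "f \<in> borel_measurable borel" "g \<in> borel_measurable borel"
    using f g by (auto dest: borel_measurable_integrable)
  have m: "(\<lambda>z. f (fst z) * (g (snd z) * k (fst z) (snd z))) \<in> borel_measurable (lborel \<Otimes>\<^sub>M lborel)"
    using assms(3) by (simp add: split_beta')
  have gk: "integrable lborel (\<lambda>y. g y * k x y)" for x
  proof (rule Bochner_Integration.integrable_bound[OF g])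
    show "(\<lambda>y. g y * k x y) \<in> borel_measurable lborel" by measurable
    show "AE y in lborel. norm (g y * k x y) \<le> norm (g y)"
      by (intro AE_I2) (simp add: norm_mult mult_left_le k)
  qed
  have "integrable lborel (\<lambda>x. \<integral>y. norm (f x * (g y * k x y)) \<partial>lborel)"
  proof (rule Bochner_Integration.integrable_bound)
    show "integrable lborel (\<lambda>x. norm (f x) * (\<integral>y. norm (g y) \<partial>lborel))"
      using f by auto
    show "(\<lambda>x. \<integral>y. norm (f x * (g y * k x y)) \<partial>lborel) \<in> borel_measurable lborel" by measurable
    have "(\<integral>y. norm (f x * (g y * k x y)) \<partial>lborel) \<le> norm (f x) * (\<integral>y. norm (g y) \<partial>lborel)" for x
    proof -
      have "(\<integral>y. norm (f x * (g y * k x y)) \<partial>lborel) = norm (f x) * (\<integral>y. norm (g y * k x y) \<partial>lborel)"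
        by (simp add: norm_mult)
      also have "\<dots> \<le> norm (f x) * (\<integral>y. norm (g y) \<partial>lborel)"
        by (intro mult_left_mono integral_mono integrable_norm gk g)
           (auto simp: norm_mult mult_left_le k)
      finally show ?thesis .
    qed
    then show "AE x in lborel. norm (\<integral>y. norm (f x * (g y * k x y)) \<partial>lborel)
        \<le> norm (norm (f x) * (\<integral>y. norm (g y) \<partial>lborel))"
      by (intro AE_I2) simp
  qed
  then have "integrable (lborel \<Otimes>\<^sub>M lborel) (\<lambda>z. f (fst z) * (g (snd z) * k (fst z) (snd z)))"
    by (intro lborel_pair.Fubini_integrable m) (auto intro!: AE_I2 integrable_mult_right gk)
  then have "(\<integral>y. (\<integral>x. f x * (g y * k x y) \<partial>lborel) \<partial>lborel) = (\<integral>x. (\<integral>y. f x * (g y * k x y) \<partial>lborel) \<partial>lborel)"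
    by (intro lborel_pair.Fubini_integral) (simp add: split_beta')
  moreover have "(\<integral>x. f x * (g y * k x y) \<partial>lborel) = g y * (\<integral>x. f x * k x y \<partial>lborel)" for y
    by (subst integral_mult_right_zero[symmetric]) (simp add: mult_ac)
  ultimately show ?thesis by simp
qed

text \<open>Its dilates, normalised by the integral of \<open>bump_ft\<close>, are the approximate
  identity; convolving with them keeps the spectrum compact.\<close>

definition bump_ft :: "real \<Rightarrow> complex" where
  "bump_ft = ft (\<lambda>x. complex_of_real (bump 1 x))"

lemma bump_integrable: "r \<ge> 0 \<Longrightarrow> integrable lborel (\<lambda>x. complex_of_real (bump r x))"
  by (intro integrable_vanishes_beyond[of _ r] C2_continuous C2_of_real C2_bump
      vanishes_beyond_of_real vanishes_beyond_bump)

lemma bump_ft_integrable: "integrable lborel bump_ft"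
  unfolding bump_ft_def
  by (rule integrable_ft[OF C2_of_real[OF C2_bump] vanishes_beyond_of_real[OF vanishes_beyond_bump[of 1]]]) simp

lemma std_normal_fourier:
  "(\<integral>y. complex_of_real (std_normal_density y) * exp (- (\<i> * complex_of_real (y * x))) \<partial>lborel)
     = of_real (exp (- x\<^sup>2 / 2))"
proof -
  have "char std_normal_distribution (- x)
      = (\<integral>y. std_normal_density y *\<^sub>R exp (\<i> * complex_of_real (- x * y)) \<partial>lborel)"
    unfolding char_def by (subst integral_density) auto
  then show ?thesis
    by (simp add: char_std_normal_distribution scaleR_conv_of_real mult_ac)
qed

text \<open>The integral equals \<open>2 \<pi> bump 1 0\<close> by Fourier inversion at the origin; here by Gaussian summation.\<close>

lemma integral_bump_ft_nonzero: "(\<integral>t. bump_ft t \<partial>lborel) \<noteq> 0"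
proof -
  let ?g = "std_normal_density"
  let ?b = "\<lambda>x. complex_of_real (bump 1 x)"
  have [measurable]: "bump 1 \<in> borel_measurable borel"
    by (intro borel_measurable_continuous_onI C2_continuous C2_bump)
  have [measurable]: "bump_ft \<in> borel_measurable borel"
    using bump_ft_integrable by (auto dest: borel_measurable_integrable)
  have g_int: "integrable lborel (\<lambda>t. complex_of_real (?g t))"
    by (rule integrable_of_real) (simp add: integrable_normal_density)
  have gauss_int: "integrable lborel (\<lambda>v::real. exp (- v\<^sup>2 / 2))"
  proof -
    have "(\<lambda>v::real. exp (- v\<^sup>2 / 2)) = (\<lambda>v. sqrt (2 * pi) * ?g v)"
      by (simp add: std_normal_density_def)
    then show ?thesis by (simp add: integrable_normal_density)
  qed
  \<comment> \<open>The multiplication formula: the transform moves from the bump to the Gaussian of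
    scale s, and x = s v removes s from the Gaussian.\<close>
  have key: "(\<integral>t. complex_of_real (?g (s * t)) * bump_ft t \<partial>lborel)
      = (\<integral>v. ?b (s * v) * of_real (exp (- v\<^sup>2 / 2)) \<partial>lborel)" if "s > 0" for s
  proof -
    have gs: "integrable lborel (\<lambda>t. complex_of_real (?g (s * t)))"
      using lborel_integrable_real_affine[OF g_int, of s 0] \<open>s > 0\<close> by simp
    have "(\<integral>t. complex_of_real (?g (s * t)) * bump_ft t \<partial>lborel)
        = (\<integral>t. complex_of_real (?g (s * t)) * (\<integral>x. ?b x * exp (- (\<i> * complex_of_real (t * x))) \<partial>lborel) \<partial>lborel)"
      by (simp add: bump_ft_def ft_def)
    also have "\<dots> = (\<integral>x. ?b x * (\<integral>t. complex_of_real (?g (s * t)) * exp (- (\<i> * complex_of_real (t * x))) \<partial>lborel) \<partial>lborel)"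
      by (rule Fubini_bounded_kernel[OF gs bump_integrable])
         (auto simp: norm_exp_eq_Re)
    also have "(\<lambda>x. \<integral>t. complex_of_real (?g (s * t)) * exp (- (\<i> * complex_of_real (t * x))) \<partial>lborel)
        = (\<lambda>x. of_real (1 / s * exp (- (x / s)\<^sup>2 / 2)))"
    proof (rule ext)
      fix x
      have "(\<integral>t. complex_of_real (?g (s * t)) * exp (- (\<i> * complex_of_real (t * x))) \<partial>lborel)
          = (1 / s) *\<^sub>R (\<integral>y. complex_of_real (?g y) * exp (- (\<i> * complex_of_real (y * (x / s)))) \<partial>lborel)"
        using lborel_integral_real_affine[of "1 / s"
          "\<lambda>t. complex_of_real (?g (s * t)) * exp (- (\<i> * complex_of_real (t * x)))" 0] \<open>s > 0\<close>
        by simp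
      then show "(\<integral>t. complex_of_real (?g (s * t)) * exp (- (\<i> * complex_of_real (t * x))) \<partial>lborel)
          = of_real (1 / s * exp (- (x / s)\<^sup>2 / 2))"
        unfolding std_normal_fourier by (simp add: scaleR_conv_of_real)
    qed
    also have "(\<integral>x. ?b x * of_real (1 / s * exp (- (x / s)\<^sup>2 / 2)) \<partial>lborel)
        = s *\<^sub>R (\<integral>v. ?b (s * v) * of_real (1 / s * exp (- v\<^sup>2 / 2)) \<partial>lborel)"
      using lborel_integral_real_affine[of s "\<lambda>x. ?b x * of_real (1 / s * exp (- (x / s)\<^sup>2 / 2))" 0] \<open>s > 0\<close>
      by simp
    also have "\<dots> = (\<integral>v. ?b (s * v) * of_real (exp (- v\<^sup>2 / 2)) \<partial>lborel)"
      using \<open>s > 0\<close> by (subst integral_scaleR_right[symmetric]) (simp add: scaleR_conv_of_real)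
    finally show ?thesis .
  qed
  \<comment> \<open>Now s = 1 / (n + 1) tends to 0 on both sides of \<open>key\<close>. The left
    side flattens to \<open>?g 0\<close> times the wanted integral, the right side to the bump at 0
    times the Gaussian integral.\<close>
  have lim0: "(\<lambda>n. inverse (real (Suc n)) * v) \<longlonglongrightarrow> 0" for v
    using tendsto_mult[OF LIMSEQ_inverse_real_of_nat tendsto_const[of v]] by simp
  have g_le: "?g x \<le> ?g 0" for x
    by (simp add: std_normal_density_def divide_right_mono)
  have g_cont: "isCont ?g x" for x
    unfolding std_normal_density_def[abs_def] by (intro continuous_intros) simp
  have "(\<lambda>n. \<integral>t. complex_of_real (?g (inverse (real (Suc n)) * t)) * bump_ft t \<partial>lborel)
      \<longlonglongrightarrow> (\<integral>t. complex_of_real (?g 0) * bump_ft t \<partial>lborel)"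
  proof (rule integral_dominated_convergence)
    show "integrable lborel (\<lambda>t. ?g 0 * norm (bump_ft t))"
      using bump_ft_integrable by auto
    show "AE t in lborel. (\<lambda>n. complex_of_real (?g (inverse (real (Suc n)) * t)) * bump_ft t)
        \<longlonglongrightarrow> complex_of_real (?g 0) * bump_ft t"
      by (intro AE_I2 tendsto_intros isCont_tendsto_compose[OF g_cont] lim0)
    show "AE t in lborel. norm (complex_of_real (?g (inverse (real (Suc n)) * t)) * bump_ft t)
        \<le> ?g 0 * norm (bump_ft t)" for n
      by (intro AE_I2) (simp only: norm_mult norm_of_real, intro mult_right_mono,
        simp_all add: g_le)
  qed measurable
  then have L: "(\<lambda>n. \<integral>v. ?b (inverse (real (Suc n)) * v) * of_real (exp (- v\<^sup>2 / 2)) \<partial>lborel)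
      \<longlonglongrightarrow> complex_of_real (?g 0) * (\<integral>t. bump_ft t \<partial>lborel)"
    by (simp add: key)
  have b_cont: "isCont (bump 1) x" for x
    using C2_continuous[OF C2_bump, of UNIV 1] by (simp add: continuous_on_eq_continuous_at)
  have b_le: "bump 1 x \<le> 1" for x
    by (simp add: bump_def power_le_one)
  have "(\<lambda>n. \<integral>v. ?b (inverse (real (Suc n)) * v) * of_real (exp (- v\<^sup>2 / 2)) \<partial>lborel)
      \<longlonglongrightarrow> (\<integral>v. ?b 0 * of_real (exp (- v\<^sup>2 / 2)) \<partial>lborel)"
  proof (rule integral_dominated_convergence[OF _ _ gauss_int])
    show "AE v in lborel. (\<lambda>n. ?b (inverse (real (Suc n)) * v) * of_real (exp (- v\<^sup>2 / 2)))
        \<longlonglongrightarrow> ?b 0 * of_real (exp (- v\<^sup>2 / 2))"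
      by (intro AE_I2 tendsto_intros isCont_tendsto_compose[OF b_cont] lim0)
    show "AE v in lborel. norm (?b (inverse (real (Suc n)) * v) * of_real (exp (- v\<^sup>2 / 2)))
        \<le> exp (- v\<^sup>2 / 2)" for n
      by (intro AE_I2) (simp add: norm_mult abs_of_nonneg[OF bump_nonneg] mult_left_le_one_le bump_nonneg b_le)
  qed measurable
  with L have "complex_of_real (?g 0) * (\<integral>t. bump_ft t \<partial>lborel)
      = (\<integral>v. ?b 0 * of_real (exp (- v\<^sup>2 / 2)) \<partial>lborel)"
    by (rule LIMSEQ_unique)
  \<comment> \<open>Here \<open>bump 1 0 = 1\<close>, so what remains is the Gaussian integral, of
    value \<open>sqrt (2 * pi)\<close>.\<close>
  also have "\<dots> = of_real (\<integral>v. exp (- v\<^sup>2 / 2) \<partial>lborel)"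
    by (simp add: bump_def integral_complex_of_real)
  also have "(\<lambda>v. exp (- v\<^sup>2 / 2)) = (\<lambda>v. sqrt (2 * pi) * ?g v)"
    by (simp add: std_normal_density_def)
  also have "(\<integral>v. sqrt (2 * pi) * ?g v \<partial>lborel) = sqrt (2 * pi)"
    by (simp add: integral_normal_density)
  finally show ?thesis by auto
qed

text \<open>For k = 0 this is \<open>2 * pi\<close> times the inverse Fourier transform of the
  indicator of [a, b]; k counts derivatives in x. The gauge integral over \<open>cbox a b\<close> is
  the form in which the Leibniz rule applies.\<close>

definition interval_exp :: "real \<Rightarrow> real \<Rightarrow> nat \<Rightarrow> real \<Rightarrow> complex" where
  "interval_exp a b k x = integral (cbox a b) (\<lambda>s. (\<i> * of_real s) ^ k * exp (\<i> * complex_of_real (s * x)))"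

lemma C2_interval_exp: "C2 (interval_exp a b 0)"
proof -
  have d: "(interval_exp a b k has_vector_derivative interval_exp a b (Suc k) x) (at x)" for k x
  proof -
    have "((\<lambda>x. integral (cbox a b) (\<lambda>s. (\<i> * of_real s) ^ k * exp (\<i> * complex_of_real (s * x))))
      has_vector_derivative
      integral (cbox a b) (\<lambda>s. (\<i> * of_real s) ^ k * (\<i> * of_real s * exp (\<i> * complex_of_real (s * x)))))
      (at x within UNIV)"
    proof (rule leibniz_rule_vector_derivative)
      show "continuous_on (UNIV \<times> cbox a b)
        (\<lambda>(x, s). (\<i> * of_real s) ^ k * (\<i> * of_real s * exp (\<i> * complex_of_real (s * x))))"
        unfolding split_beta' by (intro continuous_intros)
      show "(\<lambda>s. (\<i> * of_real s) ^ k * exp (\<i> * complex_of_real (s * x))) integrable_on cbox a b" for x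
        by (intro integrable_continuous continuous_intros)
    qed (auto intro!: has_vector_derivative_mult_right has_vector_derivative_exp_ii
        simp del: of_real_mult)
    then show ?thesis by (simp add: interval_exp_def[abs_def] mult_ac)
  qed
  then have "has_C2_derivs (interval_exp a b 0) (interval_exp a b 1) (interval_exp a b 2)"
    \<comment> \<open>The instance at 2 provides the continuity of the second derivative.\<close>
    using d[of 0] d[of 1] d[of 2]
    by (auto simp: has_C2_derivs_def numeral_2_eq_2 numeral_3_eq_3 intro!: continuous_at_imp_continuous_on
      has_vector_derivative_continuous)
  then show ?thesis unfolding C2_def by blast
qed

lemma interval_exp_eq_lborel:
  "interval_exp a b 0 x = (\<integral>s. indicator {a..b} s * exp (\<i> * complex_of_real (s * x)) \<partial>lborel)"
proof -
  have "set_integrable lborel {a..b} (\<lambda>s. exp (\<i> * complex_of_real (s * x)))"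
    unfolding set_integrable_def
    by (intro borel_integrable_compact) (auto intro!: continuous_intros)
  from set_borel_integral_eq_integral(2)[OF this] show ?thesis
    by (simp add: interval_exp_def set_lebesgue_integral_def scaleR_conv_of_real of_real_indicator)
qed

lemma ft_dilate:
  assumes "n > 0"
  shows "ft (\<lambda>x. u (x / n)) t = of_real n * ft u (n * t)"
  using lborel_integral_real_affine[of n "\<lambda>x. u (x / n) * exp (- (\<i> * complex_of_real (t * x)))" 0] assms
  by (simp add: ft_def scaleR_conv_of_real mult_ac)

lemma integrable_indicator_Icc: "integrable lborel (indicator {a..b} :: real \<Rightarrow> complex)"
  using borel_integrable_compact[of "{a..b}" "\<lambda>s. 1 :: complex"]
  by (simp add: scaleR_conv_of_real of_real_indicator)

text \<open>Products become convolutions: Fubini leaves the indicator convolved with the kernel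
  \<open>n * bump_ft (n * s)\<close>, and substituting s = t - u/n moves the dilation into the
  indicator.\<close>

lemma ft_bump_interval_exp:
  assumes "n > 0"
  shows "ft (\<lambda>x. of_real (bump 1 (x / n)) * interval_exp a b 0 x) t
    = (\<integral>u. indicator {a..b} (t - u / n) * bump_ft u \<partial>lborel)"
proof -
  let ?b = "\<lambda>x. complex_of_real (bump 1 (x / n))"
  have bi: "integrable lborel ?b"
    using lborel_integrable_real_affine[OF bump_integrable[of 1], of "1 / n" 0] assms by simp
  have "ft (\<lambda>x. ?b x * interval_exp a b 0 x) t
      = (\<integral>x. (?b x * exp (- (\<i> * complex_of_real (t * x)))) *
          (\<integral>s. indicator {a..b} s * exp (\<i> * complex_of_real (s * x)) \<partial>lborel) \<partial>lborel)"
    by (simp add: ft_def interval_exp_eq_lborel mult_ac)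
  also have "\<dots> = (\<integral>s. indicator {a..b} s *
      (\<integral>x. (?b x * exp (- (\<i> * complex_of_real (t * x)))) * exp (\<i> * complex_of_real (s * x)) \<partial>lborel) \<partial>lborel)"
    by (rule Fubini_bounded_kernel[OF integrable_ft_integrand[OF bi] integrable_indicator_Icc]) (auto simp: norm_exp_eq_Re)
  also have "(\<lambda>s. \<integral>x. (?b x * exp (- (\<i> * complex_of_real (t * x)))) * exp (\<i> * complex_of_real (s * x)) \<partial>lborel)
      = (\<lambda>s. of_real n * bump_ft (n * (t - s)))"
  proof (rule ext)
    fix s
    have "exp (- (\<i> * complex_of_real (t * x))) * exp (\<i> * complex_of_real (s * x))
        = exp (- (\<i> * complex_of_real ((t - s) * x)))" for x
      by (simp add: exp_add[symmetric] algebra_simps)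
    then have "(\<integral>x. (?b x * exp (- (\<i> * complex_of_real (t * x)))) * exp (\<i> * complex_of_real (s * x)) \<partial>lborel)
        = ft ?b (t - s)"
      by (simp only: ft_def mult.assoc)
    also have "\<dots> = of_real n * bump_ft (n * (t - s))"
      unfolding bump_ft_def by (rule ft_dilate[OF assms])
    finally show "(\<integral>x. (?b x * exp (- (\<i> * complex_of_real (t * x)))) * exp (\<i> * complex_of_real (s * x)) \<partial>lborel)
        = of_real n * bump_ft (n * (t - s))" .
  qed
  also have "(\<integral>s. indicator {a..b} s * (of_real n * bump_ft (n * (t - s))) \<partial>lborel)
      = (1 / n) *\<^sub>R (\<integral>u. indicator {a..b} (t - u / n) * (of_real n * bump_ft u) \<partial>lborel)"
    using lborel_integral_real_affine[of "- 1 / n" "\<lambda>s. indicator {a..b} s * (of_real n * bump_ft (n * (t - s)))" t] assms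
    by (simp add: algebra_simps)
  also have "\<dots> = (\<integral>u. indicator {a..b} (t - u / n) * bump_ft u \<partial>lborel)"
    using assms by (subst integral_scaleR_right[symmetric]) (simp add: scaleR_conv_of_real)
  finally show ?thesis .
qed

text \<open>The two indicators differ only within \<bar>v\<bar> of an endpoint, which gives two
  intervals of length \<open>2 * \<bar>v\<bar>\<close>. The other bound is the total length of both
  intervals; the first yields convergence as v tends to 0, the second a domination uniform in
  v.\<close>

lemma indicator_translate_diff_le:
  assumes "a \<le> b"
  shows "(\<integral>\<^sup>+t. ennreal (norm (indicator {a..b} t - indicator {a..b} (t - v) :: complex)) \<partial>lborel)
    \<le> ennreal (min (4 * \<bar>v\<bar>) (2 * (b - a)))"
proof -
  have "(\<integral>\<^sup>+t. ennreal (norm (indicator {a..b} t - indicator {a..b} (t - v) :: complex)) \<partial>lborel)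
      \<le> (\<integral>\<^sup>+t. indicator {a-\<bar>v\<bar>..a+\<bar>v\<bar>} t + indicator {b-\<bar>v\<bar>..b+\<bar>v\<bar>} t \<partial>lborel)"
    by (intro nn_integral_mono) (auto simp: indicator_def)
  also have "\<dots> = ennreal (4 * \<bar>v\<bar>)"
    by (subst nn_integral_add) (auto simp: ennreal_plus[symmetric] simp del: ennreal_plus)
  finally have 1: "(\<integral>\<^sup>+t. ennreal (norm (indicator {a..b} t - indicator {a..b} (t - v) :: complex)) \<partial>lborel)
    \<le> ennreal (4 * \<bar>v\<bar>)" .
  have "(\<integral>\<^sup>+t. ennreal (norm (indicator {a..b} t - indicator {a..b} (t - v) :: complex)) \<partial>lborel)
      \<le> (\<integral>\<^sup>+t. indicator {a..b} t + indicator {a+v..b+v} t \<partial>lborel)"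
    by (intro nn_integral_mono) (auto simp: indicator_def)
  also have "\<dots> = ennreal (2 * (b - a))"
    using assms by (subst nn_integral_add) (auto simp: ennreal_plus[symmetric] simp del: ennreal_plus)
  finally show ?thesis using 1 by (simp add: min_def)
qed

text \<open>Writing c as the integral of K and exchanging integrals bounds the error by the mean of
  the translation modulus at u/(n+1) weighted by \<open>norm (K u)\<close>; dominated convergence
  finishes. The nonnegative integral lets the error be estimated before the convolution is known to
  be integrable.\<close>

lemma approx_indicator:
  fixes K :: "real \<Rightarrow> complex"
  assumes K: "integrable lborel K" and "a \<le> b"
  defines "c \<equiv> (\<integral>u. K u \<partial>lborel)"
  shows "(\<lambda>n. \<integral>\<^sup>+t. norm (c * indicator {a..b} t
      - (\<integral>u. indicator {a..b} (t - u / real (Suc n)) * K u \<partial>lborel)) \<partial>lborel) \<longlonglongrightarrow> 0"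
proof -
  have [measurable]: "K \<in> borel_measurable borel" using K by (auto dest: borel_measurable_integrable)
  let ?I = "\<lambda>t. indicator {a..b} t :: complex"
  let ?W = "\<lambda>v. min (4 * \<bar>v\<bar>) (2 * (b - a))"
  let ?B = "\<lambda>n. \<integral>u. norm (K u) * ?W (u / real (Suc n)) \<partial>lborel"
  have W0: "?W v \<ge> 0" for v using \<open>a \<le> b\<close> by simp
  have Kb: "integrable lborel (\<lambda>u. norm (K u) * (2 * (b - a)))" using K by auto
  have Wint: "integrable lborel (\<lambda>u. norm (K u) * ?W (u / real (Suc n)))" for n
    by (rule Bochner_Integration.integrable_bound[OF Kb])
       (use \<open>a \<le> b\<close> in \<open>auto intro!: AE_I2 mult_left_mono\<close>)
  have le: "(\<integral>\<^sup>+t. norm (c * ?I t - (\<integral>u. ?I (t - u / real (Suc n)) * K u \<partial>lborel)) \<partial>lborel) \<le> ennreal (?B n)" for n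
  proof -
    let ?N = "real (Suc n)"
    have i: "integrable lborel (\<lambda>u. ?I (t - u / ?N) * K u)" for t
      by (rule Bochner_Integration.integrable_bound[OF K]) (auto intro!: AE_I2 simp: indicator_def)
    have "norm (c * ?I t - (\<integral>u. ?I (t - u / ?N) * K u \<partial>lborel))
        \<le> (\<integral>\<^sup>+u. ennreal (norm (K u)) * ennreal (norm (?I t - ?I (t - u / ?N))) \<partial>lborel)" for t
    proof -
      have "c * ?I t - (\<integral>u. ?I (t - u / ?N) * K u \<partial>lborel) = (\<integral>u. K u * (?I t - ?I (t - u / ?N)) \<partial>lborel)"
        using i[of t] K by (simp add: c_def right_diff_distrib mult.commute)
      moreover have "ennreal (norm (\<integral>u. K u * (?I t - ?I (t - u / ?N)) \<partial>lborel))
          \<le> (\<integral>\<^sup>+u. ennreal (norm (K u * (?I t - ?I (t - u / ?N)))) \<partial>lborel)"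
        by (rule integral_norm_bound_ennreal)
           (use i[of t] K in \<open>simp add: right_diff_distrib mult.commute\<close>)
      ultimately show ?thesis by (simp add: norm_mult ennreal_mult)
    qed
    then have "(\<integral>\<^sup>+t. norm (c * ?I t - (\<integral>u. ?I (t - u / ?N) * K u \<partial>lborel)) \<partial>lborel)
        \<le> (\<integral>\<^sup>+t. (\<integral>\<^sup>+u. ennreal (norm (K u)) * ennreal (norm (?I t - ?I (t - u / ?N))) \<partial>lborel) \<partial>lborel)"
      by (intro nn_integral_mono) simp
    also have "\<dots> = (\<integral>\<^sup>+u. (\<integral>\<^sup>+t. ennreal (norm (K u)) * ennreal (norm (?I t - ?I (t - u / ?N))) \<partial>lborel) \<partial>lborel)"
      by (rule lborel_pair.Fubini') measurable
    also have "\<dots> = (\<integral>\<^sup>+u. ennreal (norm (K u)) * (\<integral>\<^sup>+t. ennreal (norm (?I t - ?I (t - u / ?N))) \<partial>lborel) \<partial>lborel)"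
      by (subst nn_integral_cmult) measurable
    also have "\<dots> \<le> (\<integral>\<^sup>+u. ennreal (norm (K u)) * ennreal (?W (u / ?N)) \<partial>lborel)"
      by (intro nn_integral_mono mult_left_mono indicator_translate_diff_le \<open>a \<le> b\<close>) simp
    also have "\<dots> = (\<integral>\<^sup>+u. ennreal (norm (K u) * ?W (u / ?N)) \<partial>lborel)"
      by (intro nn_integral_cong ennreal_mult[symmetric] W0) simp
    also have "\<dots> = ennreal (?B n)"
      by (rule nn_integral_eq_integral[OF Wint]) (use W0 in \<open>auto intro!: AE_I2 mult_nonneg_nonneg\<close>)
    finally show ?thesis .
  qed
  have lim: "(\<lambda>n. ennreal (?B n)) \<longlonglongrightarrow> 0"
  proof -
    have "(\<lambda>n. ?W (u / real (Suc n))) \<longlonglongrightarrow> 0" for u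
    proof -
      have "(\<lambda>n. ?W (u * inverse (real (Suc n)))) \<longlonglongrightarrow> ?W (u * 0)"
        by (intro tendsto_intros LIMSEQ_inverse_real_of_nat)
      then show ?thesis using \<open>a \<le> b\<close> by (simp add: divide_inverse)
    qed
    then have l: "(\<lambda>n. norm (K u) * ?W (u / real (Suc n))) \<longlonglongrightarrow> 0" for u
      by (rule tendsto_mult_right_zero)
    have "?B \<longlonglongrightarrow> integral\<^sup>L (lborel :: real measure) (\<lambda>u. 0)"
    proof (rule integral_dominated_convergence[where w="\<lambda>u. norm (K u) * (2 * (b - a))"])
      show "AE u in lborel. norm (norm (K u) * ?W (u / real (Suc n))) \<le> norm (K u) * (2 * (b - a))" for n
        using \<open>a \<le> b\<close> by (intro AE_I2) (auto simp: abs_mult intro!: mult_left_mono)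
      show "AE u in lborel. (\<lambda>n. norm (K u) * ?W (u / real (Suc n))) \<longlonglongrightarrow> 0"
        using l by (intro AE_I2)
    qed (use Kb in measurable)
    from tendsto_ennrealI[OF this] show ?thesis
      by (simp only: Bochner_Integration.integral_zero ennreal_0)
  qed
  show ?thesis
    by (rule tendsto_sandwich[OF _ _ tendsto_const lim]) (rule always_eventually, rule allI, rule le zero_le)+
qed

section \<open>Density of the targets\<close>

lemma in_L1_span_dominated:
  assumes \<phi>: "integrable lborel \<phi>" and s: "\<And>i::nat. in_L1_span \<Lambda> \<phi> (s i)"
    and [measurable]: "f \<in> borel_measurable borel" and w: "integrable lborel w"
    and lim: "\<And>x. (\<lambda>i. s i x) \<longlonglongrightarrow> f x" and dom: "\<And>i x. norm (s i x) \<le> w x"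
  shows "in_L1_span \<Lambda> \<phi> f"
proof -
  have si: "integrable lborel (s i)" for i using s by (simp add: in_L1_span_def)
  then have [measurable]: "s i \<in> borel_measurable borel" for i by (auto dest: borel_measurable_integrable)
  have f: "integrable lborel f"
    by (rule integrable_dominated_convergence[OF _ _ w, of f s])
       (use lim dom si in \<open>auto intro!: AE_I2\<close>)
  have "(\<lambda>i. \<integral>x. norm (f x - s i x) \<partial>lborel) \<longlonglongrightarrow> integral\<^sup>L (lborel :: real measure) (\<lambda>x. 0)"
  proof (rule integral_dominated_convergence[where w="\<lambda>x. norm (f x) + w x"])
    show "integrable lborel (\<lambda>x. norm (f x) + w x)" using f w by auto
    show "AE x in lborel. (\<lambda>i. norm (f x - s i x)) \<longlonglongrightarrow> 0"
    proof (intro AE_I2)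
      fix x
      show "(\<lambda>i. norm (f x - s i x)) \<longlonglongrightarrow> 0"
        using tendsto_norm[OF tendsto_diff[OF tendsto_const lim[of x]], of "f x"] by simp
    qed
    show "AE x in lborel. norm (norm (f x - s i x)) \<le> norm (f x) + w x" for i
    proof (intro AE_I2)
      fix x
      show "norm (norm (f x - s i x)) \<le> norm (f x) + w x"
        using norm_triangle_ineq4[of "f x" "s i x"] dom[of i x] by simp
    qed
  qed measurable
  then have L: "(\<lambda>i. \<integral>x. norm (f x - s i x) \<partial>lborel) \<longlonglongrightarrow> 0" by simp
  show ?thesis
  proof (rule in_L1_span_lim[OF \<phi> f])
    fix \<epsilon> :: real assume "\<epsilon> > 0"
    from order_tendstoD(2)[OF L this] obtain i where "(\<integral>x. norm (f x - s i x) \<partial>lborel) < \<epsilon>"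
      by (auto simp: eventually_sequentially)
    then show "\<exists>g. in_L1_span \<Lambda> \<phi> g \<and> (\<integral>t. norm (f t - g t) \<partial>lborel) < \<epsilon>"
      using s by blast
  qed
qed

lemma in_L1_span_sum:
  assumes \<phi>: "integrable lborel \<phi>" and "\<And>i. in_L1_span \<Lambda> \<phi> (s i)"
  shows "in_L1_span \<Lambda> \<phi> (\<lambda>t. \<Sum>i<(n::nat). s i t)"
proof (induction n)
  case 0
  show ?case using in_L1_span_cmult[OF assms(2), of 0] by simp
next
  case (Suc n)
  then show ?case using in_L1_span_add[OF \<phi> Suc assms(2)[of n]] by simp
qed

text \<open>The construction reaches only countably many targets, hence rational endpoints. Moving
  each real endpoint outwards by less than \<epsilon>/4 changes the indicator on two short intervals
  only.\<close>

lemma in_L1_span_Icc_of_rational: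
  assumes \<phi>: "integrable lborel \<phi>"
    and rat: "\<And>a b :: rat. a \<le> b \<Longrightarrow> in_L1_span \<Lambda> \<phi> (indicator {of_rat a..of_rat b})"
    and "a \<le> b"
  shows "in_L1_span \<Lambda> \<phi> (indicator {a..b})"
proof (rule in_L1_span_lim[OF \<phi> integrable_indicator_Icc])
  fix \<epsilon> :: real assume "\<epsilon> > 0"
  obtain p where p: "a - \<epsilon> / 4 < of_rat p" "of_rat p < a"
    using of_rat_dense[of "a - \<epsilon> / 4" a] \<open>\<epsilon> > 0\<close> by auto
  obtain q where q: "b < of_rat q" "of_rat q < b + \<epsilon> / 4"
    using of_rat_dense[of b "b + \<epsilon> / 4"] \<open>\<epsilon> > 0\<close> by auto
  have "real_of_rat p \<le> of_rat q" using p q \<open>a \<le> b\<close> by linarith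
  then have "p \<le> q" by (simp add: of_rat_less_eq)
  have "(\<integral>t. norm (indicator {a..b} t - indicator {of_rat p..of_rat q} t :: complex) \<partial>lborel)
      \<le> (\<integral>t. indicator {of_rat p..a} t + indicator {b..of_rat q} t \<partial>lborel)"
  proof (rule integral_mono)
    show "integrable lborel (\<lambda>t. norm (indicator {a..b} t - indicator {of_rat p..of_rat q} t :: complex))"
      by (intro integrable_norm Bochner_Integration.integrable_diff integrable_indicator_Icc)
    show "integrable lborel (\<lambda>t. indicator {of_rat p..a} t + indicator {b..of_rat q} t :: real)"
      by (intro Bochner_Integration.integrable_add) (auto simp: integrable_indicator_iff emeasure_lborel_Icc_eq)
  qed (use p q in \<open>auto simp: indicator_def\<close>)
  also have "\<dots> = (a - of_rat p) + (of_rat q - b)"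
    using p q by (subst Bochner_Integration.integral_add) (auto simp: integrable_indicator_iff emeasure_lborel_Icc_eq)
  also have "\<dots> < \<epsilon>" using p q \<open>\<epsilon> > 0\<close> by linarith
  finally show "\<exists>g. in_L1_span \<Lambda> \<phi> g \<and> (\<integral>t. norm (indicator {a..b} t - g t) \<partial>lborel) < \<epsilon>"
    using rat[OF \<open>p \<le> q\<close>] by blast
qed

text \<open>Half-lines generate the Borel sets and are stable under intersection. Cutting with the
  window [-m, m] turns them into intervals and keeps complements integrable, so a Dynkin induction
  runs inside the window. Growing windows then give sets of finite measure, and simple functions
  give the rest.\<close>

lemma in_L1_span_all:
  assumes \<phi>: "integrable lborel \<phi>"
    and Icc: "\<And>a b :: real. a \<le> b \<Longrightarrow> in_L1_span \<Lambda> \<phi> (indicator {a..b})"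
    and f: "integrable lborel f"
  shows "in_L1_span \<Lambda> \<phi> f"
proof -
  let ?S = "in_L1_span \<Lambda> \<phi>"
  have S0: "?S (\<lambda>x. 0)" using in_L1_span_cmult[OF Icc[of 0 0], of 0] by simp
  have bounded_part: "?S (indicator (A \<inter> {-m..m}))" if A: "A \<in> sets borel" and "m \<ge> 0" for A m
  proof -
    have "Int_stable (range (\<lambda>a::real. {..a}))"
      by (auto simp: Int_stable_def)
    moreover have "range (\<lambda>a::real. {..a}) \<subseteq> Pow UNIV" by simp
    moreover have "A \<in> sigma_sets UNIV (range (\<lambda>a::real. {..a}))"
      using A unfolding borel_eq_atMost by simp
    ultimately show ?thesis
    proof (induction rule: sigma_sets_induct_disjoint)
      case (basic B)
      then obtain a where B: "B = {..a}" by auto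
      show ?case
      proof (cases "- m \<le> a")
        case True
        then have "B \<inter> {-m..m} = {-m..min a m}" "-m \<le> min a m" using \<open>m \<ge> 0\<close> by (auto simp: B)
        then show ?thesis using Icc by simp
      next
        case False
        then have "B \<inter> {-m..m} = {}" by (auto simp: B)
        then show ?thesis using S0 by (simp add: indicator_def[abs_def])
      qed
    next
      case empty
      then show ?case using S0 by (simp add: indicator_def[abs_def])
    next
      case (compl B)
      have "?S (\<lambda>x. indicator {-m..m} x + (-1) * indicator (B \<inter> {-m..m}) x)"
        by (intro in_L1_span_add[OF \<phi>] in_L1_span_cmult Icc compl) (use \<open>m \<ge> 0\<close> in simp)
      also have "(\<lambda>x. indicator {-m..m} x + (-1) * indicator (B \<inter> {-m..m}) x)
          = (indicator ((UNIV - B) \<inter> {-m..m}) :: real \<Rightarrow> complex)"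
        by (auto simp: indicator_def)
      finally show ?case .
    next
      case (union B)
      have B: "B i \<in> sets borel" for i using union(2) unfolding borel_eq_atMost by auto
      have dj: "disjoint_family (\<lambda>i. B i \<inter> {-m..m})"
        using union(1) by (auto simp: disjoint_family_on_def)
      show ?case
      proof (rule in_L1_span_dominated[OF \<phi>, of _ "\<lambda>n x. \<Sum>i<n. indicator (B i \<inter> {-m..m}) x"])
        show "?S (\<lambda>x. \<Sum>i<n. indicator (B i \<inter> {-m..m}) x)" for n
          by (rule in_L1_span_sum[OF \<phi> union(3)])
        show "indicator (\<Union> (range B) \<inter> {-m..m}) \<in> borel_measurable borel"
          using B by measurable
        show "integrable lborel (indicator {-m..m} :: real \<Rightarrow> real)"
          by (simp add: integrable_indicator_iff emeasure_lborel_Icc_eq)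
        have U: "\<Union> (range B) \<inter> {-m..m} = (\<Union>i. B i \<inter> {-m..m})" by auto
        have sums: "(\<lambda>i. indicator (B i \<inter> {-m..m}) x :: real) sums indicator (\<Union>i. B i \<inter> {-m..m}) x" for x
          by (rule indicator_sums) (use dj in \<open>auto simp: disjoint_family_on_def\<close>)
        show "(\<lambda>n. \<Sum>i<n. indicator (B i \<inter> {-m..m}) x) \<longlonglongrightarrow> (indicator (\<Union> (range B) \<inter> {-m..m}) x :: complex)" for x
          using sums_of_real[OF sums[of x], where 'a = complex]
          unfolding U sums_def by (simp add: of_real_indicator)
        \<comment> \<open>Disjointness keeps every partial sum below the indicator of the union,
          hence below that of the window, which is the integrable majorant.\<close>
        show "norm (\<Sum>i<n. indicator (B i \<inter> {-m..m}) x :: complex) \<le> indicator {-m..m} x" for n x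
        proof -
          have "norm (\<Sum>i<n. indicator (B i \<inter> {-m..m}) x :: complex)
              \<le> (\<Sum>i<n. indicator (B i \<inter> {-m..m}) x)"
            by (rule order_trans[OF norm_sum]) (intro sum_mono, simp split: split_indicator)
          also have "\<dots> \<le> indicator (\<Union>i. B i \<inter> {-m..m}) x"
            using sum_le_suminf[OF sums_summable[OF sums[of x]], of "{..<n}"] sums_unique[OF sums[of x]] by simp
          also have "\<dots> \<le> indicator {-m..m} x" by (auto simp: indicator_def)
          finally show ?thesis .
        qed
      qed
    qed
  qed
  show ?thesis using f
  proof (induction rule: integrable_induct)
    case (base A c)
    have iA: "integrable lborel (indicator A :: real \<Rightarrow> real)" using base by (simp add: integrable_indicator_iff)
    have "?S (indicator A)"
    proof (rule in_L1_span_dominated[OF \<phi>, of _ "\<lambda>n. indicator (A \<inter> {- real n..real n})"])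
      show "?S (indicator (A \<inter> {- real n..real n}))" for n
        using base by (intro bounded_part) auto
      show "indicator A \<in> borel_measurable borel" using base by simp
      show "integrable lborel (indicator A :: real \<Rightarrow> real)" by (rule iA)
      show "norm (indicator (A \<inter> {- real n..real n}) x :: complex) \<le> indicator A x" for n x
        by (auto simp: indicator_def)
      show "(\<lambda>n. indicator (A \<inter> {- real n..real n}) x :: complex) \<longlonglongrightarrow> indicator A x" for x
      proof (rule tendsto_eventually)
        obtain k where k: "\<bar>x\<bar> \<le> real k" using real_arch_simple by blast
        show "\<forall>\<^sub>F n in sequentially. indicator (A \<inter> {- real n..real n}) x = (indicator A x :: complex)"
          using eventually_ge_at_top[of k]
          by eventually_elim (use k in \<open>auto simp: indicator_def abs_le_iff\<close>)
      qed
    qed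
    from in_L1_span_cmult[OF this, of c] show ?case
      by (simp add: scaleR_conv_of_real of_real_indicator mult.commute)
  next
    case (add f g)
    then show ?case using in_L1_span_add[OF \<phi>] by blast
  next
    case (lim f s)
    show ?case
      by (rule in_L1_span_dominated[OF \<phi>, where s=s and w="\<lambda>x. 2 * norm (f x)"])
         (use lim in \<open>auto dest: borel_measurable_integrable\<close>)
  qed
qed

lemma exists_dense_translates:
  assumes complete: "\<forall>\<rho>>0. exp_complete \<Lambda> \<rho>"
  shows "\<exists>\<phi>. integrable lborel \<phi> \<and> translates_dense_L1 \<phi> \<Lambda>"
proof -
  \<comment> \<open>The cutoff makes the support compact, as the construction requires; on the
    Fourier side it replaces the indicator of [a, b] by a smoothed one, up to a factor.\<close>
  define H where "H a b n x = complex_of_real (bump (real (Suc n)) x) * interval_exp a b 0 x" for a b n x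
  have CH: "C2 (H a b n)" for a b n
    unfolding H_def[abs_def] by (intro C2_mult C2_of_real C2_bump C2_interval_exp)
  have vH: "vanishes_beyond (real (Suc n)) (H a b n)" for a b n
    using vanishes_beyond_bump[of "real (Suc n)"] by (simp add: H_def vanishes_beyond_def)
  \<comment> \<open>Triples of two rationals and a natural number form a countable type, so
    \<open>from_nat\<close> enumerates all targets.\<close>
  define h where "h j = (case from_nat j of (a, b, n) \<Rightarrow> H (real_of_rat a) (real_of_rat b) n)" for j
  have h: "C2 (h j)" "\<exists>r. vanishes_beyond r (h j)" for j
    using CH vH by (auto simp: h_def split: prod.splits intro!: exI)
  obtain \<phi> where \<phi>: "integrable lborel \<phi>" and span: "\<And>j. in_L1_span \<Lambda> \<phi> (ft (h j))"
    by (rule dense_sequence_in_L1_span[OF complete, of h, OF h]; rule that; assumption)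
  have spanH: "in_L1_span \<Lambda> \<phi> (ft (H (real_of_rat a) (real_of_rat b) n))" for a b n
    using span[of "to_nat (a, b, n)"] by (simp add: h_def)
  let ?c = "\<integral>t. bump_ft t \<partial>lborel"
  \<comment> \<open>The power 6 is the homogeneity of the bump: the cube of a quadratic.\<close>
  have ftH: "ft (H a b n) t = of_real (real (Suc n) ^ 6) *
      (\<integral>u. indicator {a..b} (t - u / real (Suc n)) * bump_ft u \<partial>lborel)" for a b n t
  proof -
    let ?N = "real (Suc n)"
    have "bump ?N x = ?N ^ 6 * bump 1 (x / ?N)" for x
    proof -
      have "?N\<^sup>2 - x\<^sup>2 = ?N\<^sup>2 * (1\<^sup>2 - (x / ?N)\<^sup>2)" by (simp add: power_divide right_diff_distrib)
      moreover have "max 0 (?N\<^sup>2 * y) = ?N\<^sup>2 * max 0 y" for y :: real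
        by (simp add: max_def zero_le_mult_iff)
      ultimately have "max 0 (?N\<^sup>2 - x\<^sup>2) = ?N\<^sup>2 * max 0 (1\<^sup>2 - (x / ?N)\<^sup>2)" by simp
      then show ?thesis by (simp add: bump_def power_mult_distrib power_mult[symmetric])
    qed
    then have "H a b n = (\<lambda>x. of_real (?N ^ 6) * (of_real (bump 1 (x / ?N)) * interval_exp a b 0 x))"
      by (simp only: H_def[abs_def] of_real_mult mult.assoc)
    then show ?thesis
      using ft_bump_interval_exp[of ?N a b t] by (simp only: ft_cmult)
  qed
  have "in_L1_span \<Lambda> \<phi> (indicator {of_rat a..of_rat b})" if "a \<le> b" for a b :: rat
  proof -
    let ?a = "real_of_rat a" and ?b = "real_of_rat b"
    have "?a \<le> ?b" using that by (simp add: of_rat_less_eq)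
    have "in_L1_span \<Lambda> \<phi> (\<lambda>t. ?c * indicator {?a..?b} t)"
    proof (rule in_L1_span_lim[OF \<phi>])
      show ci: "integrable lborel (\<lambda>t. ?c * indicator {?a..?b} t)"
        by (intro integrable_mult_right integrable_indicator_Icc)
      fix \<epsilon> :: real assume "\<epsilon> > 0"
      then have "0 < ennreal \<epsilon>" by simp
      from order_tendstoD(2)[OF approx_indicator[OF bump_ft_integrable \<open>?a \<le> ?b\<close>] this]
      obtain n where n: "(\<integral>\<^sup>+t. norm (?c * indicator {?a..?b} t
        - (\<integral>u. indicator {?a..?b} (t - u / real (Suc n)) * bump_ft u \<partial>lborel)) \<partial>lborel) < ennreal \<epsilon>"
        by (auto simp: eventually_sequentially)
      let ?g = "\<lambda>t. inverse (of_real (real (Suc n) ^ 6)) * ft (H ?a ?b n) t"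
      have g: "?g t = (\<integral>u. indicator {?a..?b} (t - u / real (Suc n)) * bump_ft u \<partial>lborel)" for t
        unfolding ftH by (simp del: of_nat_Suc)
      have gS: "in_L1_span \<Lambda> \<phi> ?g" by (intro in_L1_span_cmult spanH)
      then have "integrable lborel (\<lambda>t. norm (?c * indicator {?a..?b} t - ?g t))"
        using ci by (intro integrable_norm Bochner_Integration.integrable_diff) (simp_all only: in_L1_span_def)
      then have "ennreal (\<integral>t. norm (?c * indicator {?a..?b} t - ?g t) \<partial>lborel) < ennreal \<epsilon>"
        using n unfolding g by (subst nn_integral_eq_integral[symmetric]) auto
      then have "(\<integral>t. norm (?c * indicator {?a..?b} t - ?g t) \<partial>lborel) < \<epsilon>"
        by (simp add: ennreal_less_iff)
      with gS show "\<exists>g. in_L1_span \<Lambda> \<phi> g \<and> (\<integral>t. norm (?c * indicator {?a..?b} t - g t) \<partial>lborel) < \<epsilon>"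
        by blast
    qed
    \<comment> \<open>This division is where the nonvanishing of the integral of the kernel is
      used.\<close>
    from in_L1_span_cmult[OF this, of "inverse ?c"] show ?thesis
      using integral_bump_ft_nonzero by (simp add: mult.assoc[symmetric])
  qed
  then have "in_L1_span \<Lambda> \<phi> f" if "integrable lborel f" for f
    using in_L1_span_all[OF \<phi> in_L1_span_Icc_of_rational[OF \<phi>] that] by blast
  then have "translates_dense_L1 \<phi> \<Lambda>"
    by (simp add: translates_dense_L1_def in_L1_span_def)
  with \<phi> show ?thesis by blast
qed

section \<open>Necessity\<close>

lemma norm_ft_le: "integrable lborel f \<Longrightarrow> norm (ft f t) \<le> (\<integral>x. norm (f x) \<partial>lborel)"
  unfolding ft_def
  by (rule integral_norm_bound[THEN order_trans]) (simp add: norm_mult norm_exp_eq_Re)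

lemma ft_translate: "ft (\<lambda>t. \<phi> (t - l)) x = exp (- (\<i> * complex_of_real (x * l))) * ft \<phi> x"
proof -
  have "ft (\<lambda>t. \<phi> (t - l)) x = (\<integral>t. \<phi> t * exp (- (\<i> * complex_of_real (x * (l + t)))) \<partial>lborel)"
    using lborel_integral_real_affine[of 1 "\<lambda>t. \<phi> (t - l) * exp (- (\<i> * complex_of_real (x * t)))" l]
    by (simp add: ft_def)
  also have "\<dots> = (\<integral>t. exp (- (\<i> * complex_of_real (x * l))) * (\<phi> t * exp (- (\<i> * complex_of_real (x * t)))) \<partial>lborel)"
    by (rule Bochner_Integration.integral_cong)
       (simp_all add: distrib_left exp_add[symmetric] mult.left_commute[of _ "\<phi> _"])
  finally show ?thesis by (simp add: ft_def)
qed

lemma continuous_on_ft: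
  assumes "integrable lborel f"
  shows "continuous_on S (ft f)"
proof (rule continuous_at_imp_continuous_on, intro ballI)
  fix x
  have [measurable]: "f \<in> borel_measurable borel" using assms by (auto dest: borel_measurable_integrable)
  show "isCont (ft f) x"
  proof (rule continuous_at_sequentiallyI)
    fix u :: "nat \<Rightarrow> real" assume u: "u \<longlonglongrightarrow> x"
    show "(\<lambda>n. ft f (u n)) \<longlonglongrightarrow> ft f x"
      unfolding ft_def
    proof (rule integral_dominated_convergence[where w="\<lambda>t. norm (f t)"])
      show "integrable lborel (\<lambda>t. norm (f t))" using assms by auto
      show "AE t in lborel. (\<lambda>n. f t * exp (- (\<i> * complex_of_real (u n * t))))
          \<longlonglongrightarrow> f t * exp (- (\<i> * complex_of_real (x * t)))"
        by (intro AE_I2 tendsto_intros u)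
    qed (auto simp: norm_mult norm_exp_eq_Re)
  qed
qed

lemma ft_translates:
  assumes \<phi>: "integrable lborel \<phi>"
  shows "ft (\<lambda>t. \<Sum>l\<in>F. c l * \<phi> (t - l)) x = (\<Sum>l\<in>F. c l * exp (- (\<i> * complex_of_real (x * l)))) * ft \<phi> x"
proof -
  have "ft (\<lambda>t. \<Sum>l\<in>F. c l * \<phi> (t - l)) x = (\<Sum>l\<in>F. ft (\<lambda>t. c l * \<phi> (t - l)) x)"
    unfolding ft_def sum_distrib_right
    by (intro Bochner_Integration.integral_sum integrable_ft_integrand integrable_mult_right
        integrable_translate \<phi>)
  then show ?thesis by (simp add: ft_cmult ft_translate sum_distrib_right mult.assoc)
qed

text \<open>A zero of \<open>ft \<phi>\<close> at x is shared by every combination of translates. A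
  function whose transform at x is 1 would then stay at L1 distance at least 1 from all of them,
  since the L1 norm bounds the transform.\<close>

lemma ft_nonzero_of_translates_dense:
  assumes \<phi>: "integrable lborel \<phi>" and dense: "translates_dense_L1 \<phi> \<Lambda>"
  shows "ft \<phi> x \<noteq> 0"
proof
  assume 0: "ft \<phi> x = 0"
  define f where "f t = indicator {0..1} t *\<^sub>R exp (\<i> * complex_of_real (x * t))" for t :: real
  have f: "integrable lborel f"
    unfolding f_def[abs_def] by (rule borel_integrable_compact) (auto intro!: continuous_intros)
  have "f t * exp (- (\<i> * complex_of_real (x * t))) = indicator {0..1} t *\<^sub>R 1" for t
    by (simp add: f_def exp_minus)
  then have ftf: "ft f x = 1" by (simp add: ft_def)
  obtain F c where "finite F" "(\<integral>t. norm (f t - (\<Sum>l\<in>F. c l * \<phi> (t - l))) \<partial>lborel) < 1"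
    using dense[unfolded translates_dense_L1_def, rule_format, OF f zero_less_one] by blast
  moreover have "ft (\<lambda>t. f t - (\<Sum>l\<in>F. c l * \<phi> (t - l))) x = 1"
    by (simp add: ft_diff[OF f integrable_translates[OF \<phi>]] ft_translates[OF \<phi>] 0 ftf)
  ultimately show False
    using norm_ft_le[of "\<lambda>t. f t - (\<Sum>l\<in>F. c l * \<phi> (t - l))" x] f integrable_translates[OF \<phi>] by simp
qed

section \<open>Uniform approximation by exponentials with frequencies in \<Lambda>\<close>

definition exp_approximable :: "real set \<Rightarrow> real \<Rightarrow> (real \<Rightarrow> complex) \<Rightarrow> bool" where
  "exp_approximable \<Lambda> \<rho> f \<longleftrightarrow> (\<forall>\<epsilon>>0. \<exists>F c. finite F \<and> F \<subseteq> \<Lambda> \<and>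
     (\<forall>x\<in>{-\<rho>..\<rho>}. norm (f x - (\<Sum>l\<in>F. c l * exp (\<i> * complex_of_real (l * x)))) < \<epsilon>))"

lemma exp_approximable_exp:
  assumes \<phi>: "integrable lborel \<phi>" and dense: "translates_dense_L1 \<phi> \<Lambda>" and "\<rho> > 0"
  shows "exp_approximable \<Lambda> \<rho> (\<lambda>x. exp (\<i> * complex_of_real (s * x)))"
  unfolding exp_approximable_def
proof (intro allI impI)
  fix \<epsilon> :: real assume "\<epsilon> > 0"
  have "continuous_on {-\<rho>..\<rho>} (\<lambda>x. norm (ft \<phi> x))"
    by (intro continuous_intros continuous_on_ft \<phi>)
  then obtain x0 where x0: "\<forall>x\<in>{-\<rho>..\<rho>}. norm (ft \<phi> x0) \<le> norm (ft \<phi> x)"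
    using continuous_attains_inf[of "{-\<rho>..\<rho>}" "\<lambda>x. norm (ft \<phi> x)"] \<open>\<rho> > 0\<close> by auto
  let ?m = "norm (ft \<phi> x0)"
  have "?m > 0" using ft_nonzero_of_translates_dense[OF \<phi> dense] by simp
  have int: "integrable lborel (\<lambda>t. \<phi> (t - s))" by (rule integrable_translate[OF \<phi>])
  have "\<epsilon> * ?m > 0" using \<open>\<epsilon> > 0\<close> \<open>?m > 0\<close> by simp
  then obtain F c where F: "finite F" "F \<subseteq> \<Lambda>"
    and small: "(\<integral>t. norm (\<phi> (t - s) - (\<Sum>l\<in>F. c l * \<phi> (t - l))) \<partial>lborel) < \<epsilon> * ?m"
    using dense[unfolded translates_dense_L1_def, rule_format, OF int] by blast
  have "norm (exp (\<i> * complex_of_real (s * x)) - (\<Sum>l\<in>F. c l * exp (\<i> * complex_of_real (l * x)))) < \<epsilon>"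
    (is "norm ?d < \<epsilon>") if x: "x \<in> {-\<rho>..\<rho>}" for x
  proof -
    \<comment> \<open>Evaluating at -x turns the phases of the translates into exponentials with
      positive sign; -x stays in the symmetric interval on which \<open>norm (ft \<phi> x)\<close>
      was minimised.\<close>
    have "ft (\<lambda>t. \<phi> (t - s) - (\<Sum>l\<in>F. c l * \<phi> (t - l))) (- x) = ?d * ft \<phi> (- x)"
      by (simp add: ft_diff[OF int integrable_translates[OF \<phi>]] ft_translate ft_translates[OF \<phi>]
          left_diff_distrib mult.commute[of x])
    then have "norm ?d * norm (ft \<phi> (- x)) < \<epsilon> * ?m"
      using norm_ft_le[of "\<lambda>t. \<phi> (t - s) - (\<Sum>l\<in>F. c l * \<phi> (t - l))" "- x"] small int
        integrable_translates[OF \<phi>, where F=F and c=c] by (simp add: norm_mult)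
    moreover have "norm ?d * ?m \<le> norm ?d * norm (ft \<phi> (- x))"
      by (intro mult_left_mono x0[rule_format]) (use x in auto)
    ultimately have "norm ?d * ?m < \<epsilon> * ?m" by linarith
    then show ?thesis using \<open>?m > 0\<close> by simp
  qed
  with F show "\<exists>F c. finite F \<and> F \<subseteq> \<Lambda> \<and>
     (\<forall>x\<in>{-\<rho>..\<rho>}. norm (exp (\<i> * complex_of_real (s * x)) - (\<Sum>l\<in>F. c l * exp (\<i> * complex_of_real (l * x)))) < \<epsilon>)"
    by blast
qed

lemma exp_approximable_cmult:
  assumes "exp_approximable \<Lambda> \<rho> f"
  shows "exp_approximable \<Lambda> \<rho> (\<lambda>x. a * f x)"
  unfolding exp_approximable_def
proof (intro allI impI)
  fix \<epsilon> :: real assume "\<epsilon> > 0"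
  then have "\<epsilon> / (norm a + 1) > 0" by (simp add: add_nonneg_pos)
  then obtain F c where F: "finite F" "F \<subseteq> \<Lambda>"
    "\<forall>x\<in>{-\<rho>..\<rho>}. norm (f x - (\<Sum>l\<in>F. c l * exp (\<i> * complex_of_real (l * x)))) < \<epsilon> / (norm a + 1)"
    using assms unfolding exp_approximable_def by meson
  have "norm (a * f x - (\<Sum>l\<in>F. (a * c l) * exp (\<i> * complex_of_real (l * x)))) < \<epsilon>" if "x \<in> {-\<rho>..\<rho>}" for x
  proof -
    let ?e = "norm (f x - (\<Sum>l\<in>F. c l * exp (\<i> * complex_of_real (l * x))))"
    have "norm (a * f x - (\<Sum>l\<in>F. (a * c l) * exp (\<i> * complex_of_real (l * x)))) = norm a * ?e"
      by (simp only: norm_mult[symmetric] right_diff_distrib sum_distrib_left mult.assoc)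
    also have "\<dots> \<le> (norm a + 1) * ?e" by (simp add: mult_right_mono)
    also have "\<dots> < \<epsilon>" using bspec[OF F(3) that] by (simp add: pos_less_divide_eq add_nonneg_pos mult.commute)
    finally show ?thesis .
  qed
  with F(1,2) show "\<exists>F c. finite F \<and> F \<subseteq> \<Lambda> \<and>
     (\<forall>x\<in>{-\<rho>..\<rho>}. norm (a * f x - (\<Sum>l\<in>F. c l * exp (\<i> * complex_of_real (l * x)))) < \<epsilon>)"
    by (intro exI[of _ F] exI[of _ "\<lambda>l. a * c l"]) simp
qed

lemma exp_approximable_add:
  assumes "exp_approximable \<Lambda> \<rho> f" "exp_approximable \<Lambda> \<rho> g"
  shows "exp_approximable \<Lambda> \<rho> (\<lambda>x. f x + g x)"
  unfolding exp_approximable_def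
proof (intro allI impI)
  fix \<epsilon> :: real assume "\<epsilon> > 0"
  then have "\<epsilon> / 2 > 0" by simp
  obtain F c where F: "finite F" "F \<subseteq> \<Lambda>"
    "\<forall>x\<in>{-\<rho>..\<rho>}. norm (f x - (\<Sum>l\<in>F. c l * exp (\<i> * complex_of_real (l * x)))) < \<epsilon> / 2"
    using assms(1) \<open>\<epsilon> / 2 > 0\<close> unfolding exp_approximable_def by meson
  obtain G d where G: "finite G" "G \<subseteq> \<Lambda>"
    "\<forall>x\<in>{-\<rho>..\<rho>}. norm (g x - (\<Sum>l\<in>G. d l * exp (\<i> * complex_of_real (l * x)))) < \<epsilon> / 2"
    using assms(2) \<open>\<epsilon> / 2 > 0\<close> unfolding exp_approximable_def by meson
  let ?b = "\<lambda>l. (if l \<in> F then c l else 0) + (if l \<in> G then d l else 0)"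
  have "norm (f x + g x - (\<Sum>l\<in>F \<union> G. ?b l * exp (\<i> * complex_of_real (l * x)))) < \<epsilon>"
    if x: "x \<in> {-\<rho>..\<rho>}" for x
  proof -
    let ?e = "\<lambda>l. exp (\<i> * complex_of_real (l * x))"
    have "(\<Sum>l\<in>F \<union> G. ?b l * ?e l) = (\<Sum>l\<in>F. c l * ?e l) + (\<Sum>l\<in>G. d l * ?e l)"
      using sum_extend_zero[of "F \<union> G" F c ?e] sum_extend_zero[of "F \<union> G" G d ?e]
        F(1) G(1) by (simp only: distrib_right sum.distrib finite_Un Un_upper1 Un_upper2)
    then have "norm (f x + g x - (\<Sum>l\<in>F \<union> G. ?b l * ?e l))
        \<le> norm (f x - (\<Sum>l\<in>F. c l * ?e l)) + norm (g x - (\<Sum>l\<in>G. d l * ?e l))"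
      by (simp only: norm_diff_triangle_ineq)
    then show ?thesis using bspec[OF F(3) x] bspec[OF G(3) x] by linarith
  qed
  with F(1,2) G(1,2) show "\<exists>F c. finite F \<and> F \<subseteq> \<Lambda> \<and>
     (\<forall>x\<in>{-\<rho>..\<rho>}. norm (f x + g x - (\<Sum>l\<in>F. c l * exp (\<i> * complex_of_real (l * x)))) < \<epsilon>)"
    by (intro exI[of _ "F \<union> G"] exI[of _ ?b]) simp
qed

text \<open>Arbitrary real frequencies are allowed. The inductive form reduces products and
  approximability to the three generating rules, without bookkeeping of finite sums.\<close>

inductive trig_poly :: "(real \<Rightarrow> complex) \<Rightarrow> bool" where
  trig_exp: "trig_poly (\<lambda>x. exp (\<i> * complex_of_real (s * x)))"
| trig_add: "trig_poly f \<Longrightarrow> trig_poly g \<Longrightarrow> trig_poly (\<lambda>x. f x + g x)"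
| trig_cmult: "trig_poly f \<Longrightarrow> trig_poly (\<lambda>x. a * f x)"

lemma trig_poly_mult_exp:
  assumes "trig_poly f"
  shows "trig_poly (\<lambda>x. exp (\<i> * complex_of_real (s * x)) * f x)"
  using assms
proof induction
  case (trig_exp t)
  have "(\<lambda>x. exp (\<i> * complex_of_real (s * x)) * exp (\<i> * complex_of_real (t * x)))
      = (\<lambda>x. exp (\<i> * complex_of_real ((s + t) * x)))"
    by (simp add: exp_add[symmetric] algebra_simps)
  then show ?case by (simp only: trig_poly.trig_exp)
next
  case (trig_add f g)
  from trig_poly.trig_add[OF trig_add.IH] show ?case by (simp add: distrib_left)
next
  case (trig_cmult f a)
  from trig_poly.trig_cmult[OF trig_cmult.IH, of a] show ?case by (simp add: mult_ac)
qed

lemma trig_poly_mult: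
  assumes "trig_poly f" "trig_poly g"
  shows "trig_poly (\<lambda>x. f x * g x)"
  using assms(1)
proof induction
  case (trig_exp s)
  show ?case by (rule trig_poly_mult_exp[OF assms(2)])
next
  case (trig_add f1 f2)
  from trig_poly.trig_add[OF trig_add.IH] show ?case by (simp add: distrib_right)
next
  case (trig_cmult f a)
  from trig_poly.trig_cmult[OF trig_cmult.IH, of a] show ?case by (simp add: mult_ac)
qed

lemma trig_poly_const: "trig_poly (\<lambda>x. c)"
  using trig_cmult[OF trig_exp[of 0], of c] by simp

lemma trig_poly_continuous: "trig_poly f \<Longrightarrow> continuous_on S f"
  by (induction rule: trig_poly.induct) (auto intro!: continuous_intros)

lemma trig_poly_sin: "trig_poly (\<lambda>x. complex_of_real (sin (s * x)))"
proof -
  have "trig_poly (\<lambda>x. (- \<i> / 2) * exp (\<i> * complex_of_real (s * x))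
      + (\<i> / 2) * exp (\<i> * complex_of_real ((- s) * x)))"
    by (intro trig_add trig_cmult trig_exp)
  also have "(\<lambda>x. (- \<i> / 2) * exp (\<i> * complex_of_real (s * x))
      + (\<i> / 2) * exp (\<i> * complex_of_real ((- s) * x))) = (\<lambda>x. complex_of_real (sin (s * x)))"
  proof (rule ext)
    fix x
    have "complex_of_real (sin (s * x)) = (exp (\<i> * complex_of_real (s * x))
        - exp (- (\<i> * complex_of_real (s * x)))) / (2 * \<i>)"
      by (simp only: sin_of_real[symmetric] sin_exp_eq)
    moreover have "(a - b) / (2 * \<i>) = (- \<i> / 2) * a + (\<i> / 2) * b" for a b :: complex
      by (simp add: complex_eq_iff Re_divide Im_divide field_simps power2_eq_square)
    ultimately show "(- \<i> / 2) * exp (\<i> * complex_of_real (s * x))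
      + (\<i> / 2) * exp (\<i> * complex_of_real ((- s) * x)) = complex_of_real (sin (s * x))"
      by simp
  qed
  finally show ?thesis .
qed

text \<open>Real Stone-Weierstrass for the real functions whose complexifications are trigonometric
  polynomials, applied separately to the real and the imaginary part.\<close>

lemma trig_poly_dense:
  fixes f :: "real \<Rightarrow> complex"
  assumes "\<rho> > 0" and f: "continuous_on {-\<rho>..\<rho>} f" and "\<epsilon> > 0"
  obtains g where "trig_poly g" "\<And>x. x \<in> {-\<rho>..\<rho>} \<Longrightarrow> norm (f x - g x) < \<epsilon>"
proof -
  let ?R = "{g :: real \<Rightarrow> real. trig_poly (\<lambda>x. complex_of_real (g x))}"
  interpret function_ring_on ?R "{-\<rho>..\<rho>}"
  proof
    fix g assume "g \<in> ?R"
    then have "continuous_on {-\<rho>..\<rho>} (\<lambda>x. Re (complex_of_real (g x)))"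
      by (intro continuous_intros trig_poly_continuous) simp
    then show "continuous_on {-\<rho>..\<rho>} g" by simp
  next
    fix x y assume xy: "x \<in> {-\<rho>..\<rho>}" "y \<in> {-\<rho>..\<rho>}" "x \<noteq> y"
    \<comment> \<open>A single function separates all points: z/\<rho> lies in [-1, 1], inside the
      interval where the sine is injective.\<close>
    have range: "- (pi / 2) \<le> z / \<rho>" "z / \<rho> \<le> pi / 2" if "z \<in> {-\<rho>..\<rho>}" for z
    proof -
      have "\<bar>z\<bar> \<le> \<rho>" using that by auto
      then have "\<bar>z / \<rho>\<bar> \<le> 1" using \<open>\<rho> > 0\<close> by (simp add: abs_divide)
      then show "- (pi / 2) \<le> z / \<rho>" "z / \<rho> \<le> pi / 2" using pi_gt3 by linarith+
    qed
    have "x / \<rho> \<noteq> y / \<rho>" using xy(3) \<open>\<rho> > 0\<close> by simp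
    then have "sin (x / \<rho>) \<noteq> sin (y / \<rho>)"
      using sin_inj_pi[OF range[OF xy(1)] range[OF xy(2)]] by blast
    moreover have "(\<lambda>x. sin (x / \<rho>)) \<in> ?R"
      using trig_poly_sin[of "1 / \<rho>"] by simp
    ultimately show "\<exists>f\<in>?R. f x \<noteq> f y" by (rule_tac bexI[of _ "\<lambda>x. sin (x / \<rho>)"])
  qed (use trig_add trig_poly_mult trig_poly_const in auto)
  have "\<epsilon> / 2 > 0" using \<open>\<epsilon> > 0\<close> by simp
  obtain g1 where g1: "g1 \<in> ?R" "\<And>x. x \<in> {-\<rho>..\<rho>} \<Longrightarrow> \<bar>Re (f x) - g1 x\<bar> < \<epsilon> / 2"
    using Stone_Weierstrass_basic[OF continuous_on_Re[OF f] \<open>\<epsilon> / 2 > 0\<close>] by blast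
  obtain g2 where g2: "g2 \<in> ?R" "\<And>x. x \<in> {-\<rho>..\<rho>} \<Longrightarrow> \<bar>Im (f x) - g2 x\<bar> < \<epsilon> / 2"
    using Stone_Weierstrass_basic[OF continuous_on_Im[OF f] \<open>\<epsilon> / 2 > 0\<close>] by blast
  show thesis
  proof (rule that[of "\<lambda>x. of_real (g1 x) + \<i> * of_real (g2 x)"])
    show "trig_poly (\<lambda>x. of_real (g1 x) + \<i> * of_real (g2 x))"
      using g1(1) g2(1) by (intro trig_add trig_cmult) simp_all
    fix x assume x: "x \<in> {-\<rho>..\<rho>}"
    have "norm (f x - (of_real (g1 x) + \<i> * of_real (g2 x))) \<le> \<bar>Re (f x) - g1 x\<bar> + \<bar>Im (f x) - g2 x\<bar>"
      using cmod_le[of "f x - (of_real (g1 x) + \<i> * of_real (g2 x))"] by simp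
    with g1(2)[OF x] g2(2)[OF x]
    show "norm (f x - (of_real (g1 x) + \<i> * of_real (g2 x))) < \<epsilon>" by linarith
  qed
qed

lemma exp_complete_of_translates_dense:
  assumes \<phi>: "integrable lborel \<phi>" and dense: "translates_dense_L1 \<phi> \<Lambda>" and "\<rho> > 0"
  shows "exp_complete \<Lambda> \<rho>"
  unfolding exp_complete_def
proof (intro allI impI)
  fix f :: "real \<Rightarrow> complex" and \<epsilon> :: real
  assume f: "continuous_on {-\<rho>..\<rho>} f" and "\<epsilon> > 0"
  then have "\<epsilon> / 2 > 0" by simp
  obtain g where g: "trig_poly g" "\<And>x. x \<in> {-\<rho>..\<rho>} \<Longrightarrow> norm (f x - g x) < \<epsilon> / 2"
    using trig_poly_dense[OF \<open>\<rho> > 0\<close> f \<open>\<epsilon> / 2 > 0\<close>] by blast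
  from g(1) have "exp_approximable \<Lambda> \<rho> g"
    by induction (auto intro: exp_approximable_exp[OF assms] exp_approximable_add exp_approximable_cmult
      simp del: of_real_mult)
  then obtain F c where F: "finite F" "F \<subseteq> \<Lambda>"
    "\<forall>x\<in>{-\<rho>..\<rho>}. norm (g x - (\<Sum>l\<in>F. c l * exp (\<i> * complex_of_real (l * x)))) < \<epsilon> / 2"
    using \<open>\<epsilon> / 2 > 0\<close> unfolding exp_approximable_def by meson
  have "norm (f x - (\<Sum>l\<in>F. c l * exp (\<i> * complex_of_real (l * x)))) < \<epsilon>" if "x \<in> {-\<rho>..\<rho>}" for x
    using norm_diff_triangle_less[OF g(2)[OF that] bspec[OF F(3) that]] by simp
  with F(1,2) show "\<exists>F c. finite F \<and> F \<subseteq> \<Lambda> \<and>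
     (\<forall>x\<in>{-\<rho>..\<rho>}. norm (f x - (\<Sum>l\<in>F. c l * exp (\<i> * complex_of_real (l * x)))) < \<epsilon>)"
    by blast
qed

section \<open>Completeness on all intervals and the spectral radius\<close>

lemma exp_complete_antimono:
  assumes "exp_complete \<Lambda> \<rho>'" "0 < \<rho>" "\<rho> \<le> \<rho>'"
  shows "exp_complete \<Lambda> \<rho>"
  unfolding exp_complete_def
proof (intro allI impI)
  fix f :: "real \<Rightarrow> complex" and \<epsilon> :: real
  assume f: "continuous_on {-\<rho>..\<rho>} f" and "\<epsilon> > 0"
  \<comment> \<open>Clamping the argument extends f continuously by its endpoint values to the
    larger interval.\<close>
  define g where "g x = f (max (-\<rho>) (min \<rho> x))" for x
  have "continuous_on {-\<rho>'..\<rho>'} g"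
    unfolding g_def[abs_def]
    by (rule continuous_on_compose2[OF f]) (use \<open>0 < \<rho>\<close> in \<open>auto intro!: continuous_intros\<close>)
  then obtain F c where F: "finite F" "F \<subseteq> \<Lambda>"
    and app: "\<forall>x\<in>{-\<rho>'..\<rho>'}. norm (g x - (\<Sum>l\<in>F. c l * exp (\<i> * complex_of_real (l * x)))) < \<epsilon>"
    using assms(1) \<open>\<epsilon> > 0\<close> unfolding exp_complete_def by meson
  have "norm (f x - (\<Sum>l\<in>F. c l * exp (\<i> * complex_of_real (l * x)))) < \<epsilon>" if "x \<in> {-\<rho>..\<rho>}" for x
    using bspec[OF app, of x] that assms(3) by (simp add: g_def)
  with F show "\<exists>F c. finite F \<and> F \<subseteq> \<Lambda> \<and>
     (\<forall>x\<in>{-\<rho>..\<rho>}. norm (f x - (\<Sum>l\<in>F. c l * exp (\<i> * complex_of_real (l * x)))) < \<epsilon>)"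
    by blast
qed

lemma spectral_radius_infinite_iff:
  "spectral_radius \<Lambda> = \<infinity> \<longleftrightarrow> (\<forall>\<rho>>0. exp_complete \<Lambda> \<rho>)"
proof
  assume inf: "spectral_radius \<Lambda> = \<infinity>"
  show "\<forall>\<rho>>0. exp_complete \<Lambda> \<rho>"
  proof (intro allI impI)
    fix \<rho> :: real assume "\<rho> > 0"
    \<comment> \<open>An infinite radius rules out the fallback value 0, so it is the supremum, and
      completeness holds on some interval longer than the given one.\<close>
    have "ereal \<rho> < Sup (ereal ` {\<rho>::real. \<rho> > 0 \<and> exp_complete \<Lambda> \<rho>})"
      using inf by (auto simp: spectral_radius_def split: if_splits)
    then obtain \<rho>' where "exp_complete \<Lambda> \<rho>'" "\<rho> < \<rho>'" by (auto simp: less_Sup_iff)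
    then show "exp_complete \<Lambda> \<rho>" using exp_complete_antimono \<open>\<rho> > 0\<close> by simp
  qed
next
  assume all: "\<forall>\<rho>>0. exp_complete \<Lambda> \<rho>"
  let ?A = "{\<rho>::real. \<rho> > 0 \<and> exp_complete \<Lambda> \<rho>}"
  have "1 \<in> ?A" using all by simp
  then have "?A \<noteq> {}" by blast
  moreover have "Sup (ereal ` ?A) = \<infinity>"
  proof (rule ereal_top)
    fix B
    \<comment> \<open>The maximum with 1 keeps the witness positive when B is not.\<close>
    have "max B 1 \<in> ?A" using all by simp
    then have "ereal (max B 1) \<le> Sup (ereal ` ?A)" by (intro Sup_upper imageI)
    then show "ereal B \<le> Sup (ereal ` ?A)" by (rule order_trans[rotated]) simp
  qed
  ultimately show "spectral_radius \<Lambda> = \<infinity>" unfolding spectral_radius_def by (simp only: if_False)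
qed

theorem theorem1:
  fixes \<Lambda> :: "real set"
  assumes "discrete_real_set \<Lambda>"
  shows "(\<exists>\<phi> :: real \<Rightarrow> complex. integrable lborel \<phi> \<and> translates_dense_L1 \<phi> \<Lambda>)
         \<longleftrightarrow> spectral_radius \<Lambda> = \<infinity>"
  unfolding spectral_radius_infinite_iff
  using exists_dense_translates exp_complete_of_translates_dense by blast

end
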